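(* Let $A$ be a $C^*$-algebra of compact operators, let $(V,(\,,)_V)$ and $(W,(\,,)_W)$ be Hilbert $A$-modules, and let $(U,(\,,)_U)$ be a pre-Hilbert $A$-module which is a vector subspace of $V$ and of $W$ such that the norms $|\,|_W$ and $|\,|_U$ coincide on $U$ and $|\,|_V$ restricted to $U$ dominates $|\,|_U$. Suppose that $D\in\mathrm{End}_{PH_A^*}(U)$ is a self-adjoint morphism having a continuous adjointable extension $\widetilde{D}:V\to W$ such that (i) $\widetilde{D}$ is $A$-Fredholm, (ii) $\widetilde{D}^{-1}(U)\subseteq U$ and $\widetilde{D}^{*-1}(U)\subseteq U$ (preimages of $U$ under $\widetilde D$ and $\widetilde D^*$), and (iii) $\mathrm{Ker}\,\widetilde{D}$ and $\mathrm{Ker}\,\widetilde{D}^*$ are subsets of $U$. Then $D$ is a self-adjoint parametrix possessing operator in $U$.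
   Context: A $C^*$-algebra of compact operators is a $C^*$-subalgebra of the algebra $K(H)$ of compact operators on some (not necessarily separable) Hilbert space $H$. A pre-Hilbert $A$-module is a complex vector space $U$ that is a right $A$-module (action denoted by a dot) with a map (the $A$-product) $(\,,):U\times U\to A$ such that $(u,zv+w)=z(u,v)+(u,w)$, $(u,v\cdot a)=(u,v)a$, $(u,v)=(v,u)^*$, $(u,u)\ge 0$, and $(u,u)=0$ implies $u=0$, for $u,v,w\in U$, $a\in A$, $z\in\mathbb{C}$. Its norm is $|u|=\sqrt{|(u,u)|_A}$ (written $|\,|_U$); it is a Hilbert $A$-module if it is complete in this norm. Morphisms are continuous $A$-linear maps $L:U\to V$ that are adjointable, i.e. there is $L^*:V\to U$ with $(Lu,v)_V=(u,L^*v)_U$ for all $u\in U$, $v\in V$. $PH_A^*$ denotes the category of pre-Hilbert $A$-modules with these morphisms and $H_A^*$ its full subcategory of Hilbert $A$-modules. The adjoint $\widetilde{D}^*:W\to V$ is taken with respect to $(\,,)_V$ and $(\,,)_W$. That $|\,|_V$ dominates $|\,|_U$ means that there is a constant $C>0$ with $|u|_U\le C|u|_V$ for all $u\in U$. For Hilbert $A$-modules $U,V$ and $u\in U$, $v\in V$, the elementary operator $F_{u,v}:U\to V$ is $F_{u,v}(u')=v\cdot(u,u')$. A morphism in $H_A^*$ is of $A$-finite rank if it is a finite sum of $A$-linear combinations of elementary operators (equivalently, a finite sum of elementary operators); it is $A$-compact if it lies in the operator norm closure in $\mathrm{Hom}_{H_A^*}(U,V)$ of the $A$-finite rank morphisms.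 A morphism $F:U\to V$ in $H_A^*$ is $A$-Fredholm if there exist morphisms $G_U,G_V:V\to U$ in $H_A^*$ and $A$-compact morphisms $P_U:U\to U$, $P_V:V\to V$ with $G_UF=1_U+P_U$ and $FG_V=1_V+P_V$. An endomorphism $F:U\to U$ in $PH_A^*$ is self-adjoint parametrix possessing if $F^*=F$ and there exist a morphism $G:U\to U$ in $PH_A^*$ and a self-adjoint morphism $P:U\to U$ in $PH_A^*$ such that $1_U=GF+P$, $1_U=FG+P$ and $FP=0$. *)

theory Defs
  imports "HOL-Analysis.Analysis"
begin

class complex_vector = real_vector +
  fixes scaleC :: "complex \<Rightarrow> 'a \<Rightarrow> 'a" (infixr "*\<^sub>C" 75)
  assumes scaleC_add_right: "z *\<^sub>C (x + y) = z *\<^sub>C x + z *\<^sub>C y"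
    and scaleC_add_left: "(z + w) *\<^sub>C x = z *\<^sub>C x + w *\<^sub>C x"
    and scaleC_scaleC: "z *\<^sub>C (w *\<^sub>C x) = (z * w) *\<^sub>C x"
    and scaleR_scaleC: "r *\<^sub>R x = complex_of_real r *\<^sub>C x"

class complex_normed_vector = complex_vector + real_normed_vector +
  assumes norm_scaleC: "norm (z *\<^sub>C x) = cmod z * norm x"

class complex_inner = complex_normed_vector +
  fixes cinner :: "'a \<Rightarrow> 'a \<Rightarrow> complex"
  assumes cinner_add_right: "cinner x (y + z) = cinner x y + cinner x z"
    and cinner_scaleC_right: "cinner x (c *\<^sub>C y) = c * cinner x y"
    and cinner_commute: "cinner x y = cnj (cinner y x)"
    and cinner_self: "cinner x x = complex_of_real ((norm x)\<^sup>2)"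

class chilbert_space = complex_inner + complete_space

lemma vector_space_scaleC: "vector_space (scaleC :: complex \<Rightarrow> 'a \<Rightarrow> 'a::complex_vector)"
proof
  fix x :: 'a
  have "1 *\<^sub>C x = (1::real) *\<^sub>R x"
    by (simp only: scaleR_scaleC of_real_1)
  then show "1 *\<^sub>C x = x" by simp
qed (simp_all add: scaleC_add_right scaleC_add_left scaleC_scaleC)

global_interpretation complex_vector: vector_space "scaleC :: complex \<Rightarrow> 'a \<Rightarrow> 'a::complex_vector"
  defines csubspace = complex_vector.subspace
  by (rule vector_space_scaleC)

instantiation blinfun :: (real_normed_vector, complex_normed_vector) complex_vector
begin

lift_definition scaleC_blinfun :: "complex \<Rightarrow> ('a \<Rightarrow>\<^sub>L 'b) \<Rightarrow> 'a \<Rightarrow>\<^sub>L 'b"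
  is "\<lambda>z f x. z *\<^sub>C f x"
proof -
  fix z :: complex and f :: "'a \<Rightarrow> 'b"
  assume f: "bounded_linear f"
  interpret bounded_linear f by (rule f)
  obtain K where K: "\<And>x. norm (f x) \<le> norm x * K"
    using bounded by blast
  show "bounded_linear (\<lambda>x. z *\<^sub>C f x)"
  proof (rule bounded_linear_intro[where K = "cmod z * K"])
    show "z *\<^sub>C f (r *\<^sub>R x) = r *\<^sub>R (z *\<^sub>C f x)" for r x
      by (simp add: scale scaleR_scaleC scaleC_scaleC mult.commute)
    show "norm (z *\<^sub>C f x) \<le> norm x * (cmod z * K)" for x
      using mult_left_mono[OF K[of x], of "cmod z"] by (simp add: norm_scaleC ac_simps)
  qed (simp add: add scaleC_add_right)
qed

instance
  by standard
    (transfer, simp add: scaleC_add_right scaleC_add_left scaleC_scaleC scaleR_scaleC fun_eq_iff)+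

end

text \<open>The type \<open>'h \<Rightarrow>\<^sub>L 'h\<close> consists of the bounded \<^emph>\<open>real\<close>-linear operators on \<open>'h\<close>, with the
  operator norm; complex linearity is imposed by the next predicate.\<close>

definition clinear_op :: "('h::complex_normed_vector \<Rightarrow>\<^sub>L 'h) \<Rightarrow> bool" where
  "clinear_op a \<longleftrightarrow> (\<forall>z x. blinfun_apply a (z *\<^sub>C x) = z *\<^sub>C blinfun_apply a x)"

definition compact_op :: "('h::real_normed_vector \<Rightarrow>\<^sub>L 'h) \<Rightarrow> bool" where
  "compact_op a \<longleftrightarrow> compact (closure (blinfun_apply a ` cball 0 1))"

definition compact_operators :: "('h::complex_normed_vector \<Rightarrow>\<^sub>L 'h) set" where
  "compact_operators = {a. clinear_op a \<and> compact_op a}"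

text \<open>\<open>is_adjoint_op b a\<close> means \<open>b = a\<^sup>*\<close>.\<close>

definition is_adjoint_op :: "('h::complex_inner \<Rightarrow>\<^sub>L 'h) \<Rightarrow> ('h \<Rightarrow>\<^sub>L 'h) \<Rightarrow> bool" where
  "is_adjoint_op b a \<longleftrightarrow>
     (\<forall>x y. cinner (blinfun_apply a x) y = cinner x (blinfun_apply b y))"

definition positive_op :: "('h::complex_inner \<Rightarrow>\<^sub>L 'h) \<Rightarrow> bool" where
  "positive_op a \<longleftrightarrow> (\<forall>x. cinner x (blinfun_apply a x) \<in> \<real>\<^sub>\<ge>\<^sub>0)"

definition cstar_compact :: "('h::chilbert_space \<Rightarrow>\<^sub>L 'h) set \<Rightarrow> bool" where
  "cstar_compact A \<longleftrightarrow>
     A \<subseteq> compact_operators \<and>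
     csubspace A \<and>
     (\<forall>a\<in>A. \<forall>b\<in>A. a o\<^sub>L b \<in> A) \<and>
     (\<forall>a\<in>A. \<exists>b\<in>A. is_adjoint_op b a) \<and>
     closed A"

text \<open>All modules have their elements in one complex vector space \<open>'m\<close>, which provides the
  linear structure. So for modules \<open>M\<close>, \<open>N\<close>, the inclusion \<open>mcarrier M \<subseteq> mcarrier N\<close> says
  that \<open>M\<close> is a vector subspace of \<open>N\<close>; the actions and products of \<open>M\<close> and \<open>N\<close> are
  unrelated. Two vector spaces with a common subspace always embed, compatibly on that subspace,
  into one (their amalgamated sum), so having a common \<open>'m\<close> is no restriction.\<close>

record (overloaded) ('h::real_normed_vector, 'm) hmodule =
  mcarrier :: "'m set"
  mact :: "'m \<Rightarrow> ('h \<Rightarrow>\<^sub>L 'h) \<Rightarrow> 'm"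
  mprod :: "'m \<Rightarrow> 'm \<Rightarrow> ('h \<Rightarrow>\<^sub>L 'h)"

definition mnorm :: "('h::real_normed_vector, 'm) hmodule \<Rightarrow> 'm \<Rightarrow> real" where
  "mnorm M u = sqrt (norm (mprod M u u))"

definition right_module ::
  "('h::chilbert_space \<Rightarrow>\<^sub>L 'h) set \<Rightarrow> ('h, 'm::complex_vector) hmodule \<Rightarrow> bool" where
  "right_module A M \<longleftrightarrow>
     csubspace (mcarrier M) \<and>
     (\<forall>u\<in>mcarrier M. \<forall>a\<in>A. mact M u a \<in> mcarrier M) \<and>
     (\<forall>u\<in>mcarrier M. \<forall>v\<in>mcarrier M. \<forall>a\<in>A. mact M (u + v) a = mact M u a + mact M v a) \<and>
     (\<forall>u\<in>mcarrier M. \<forall>a\<in>A. \<forall>b\<in>A. mact M u (a + b) = mact M u a + mact M u b) \<and>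
     (\<forall>u\<in>mcarrier M. \<forall>a\<in>A. \<forall>b\<in>A. mact M u (a o\<^sub>L b) = mact M (mact M u a) b) \<and>
     (\<forall>u\<in>mcarrier M. \<forall>a\<in>A. \<forall>z. mact M (z *\<^sub>C u) a = z *\<^sub>C mact M u a \<and>
                                 mact M u (z *\<^sub>C a) = z *\<^sub>C mact M u a)"

definition pre_hilbert_module ::
  "('h::chilbert_space \<Rightarrow>\<^sub>L 'h) set \<Rightarrow> ('h, 'm::complex_vector) hmodule \<Rightarrow> bool" where
  "pre_hilbert_module A M \<longleftrightarrow>
     right_module A M \<and>
     (\<forall>u\<in>mcarrier M. \<forall>v\<in>mcarrier M. mprod M u v \<in> A) \<and>
     (\<forall>u\<in>mcarrier M. \<forall>v\<in>mcarrier M. \<forall>w\<in>mcarrier M. \<forall>z.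
        mprod M u (z *\<^sub>C v + w) = z *\<^sub>C mprod M u v + mprod M u w) \<and>
     (\<forall>u\<in>mcarrier M. \<forall>v\<in>mcarrier M. \<forall>a\<in>A. mprod M u (mact M v a) = mprod M u v o\<^sub>L a) \<and>
     (\<forall>u\<in>mcarrier M. \<forall>v\<in>mcarrier M. is_adjoint_op (mprod M u v) (mprod M v u)) \<and>
     (\<forall>u\<in>mcarrier M. positive_op (mprod M u u)) \<and>
     (\<forall>u\<in>mcarrier M. mprod M u u = 0 \<longrightarrow> u = 0)"

definition mcomplete :: "('h::real_normed_vector, 'm::complex_vector) hmodule \<Rightarrow> bool" where
  "mcomplete M \<longleftrightarrow>
     (\<forall>s :: nat \<Rightarrow> 'm. range s \<subseteq> mcarrier M \<and>
        (\<forall>e>0. \<exists>N. \<forall>m\<ge>N. \<forall>n\<ge>N. mnorm M (s m - s n) < e) \<longrightarrow>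
        (\<exists>l\<in>mcarrier M. (\<lambda>n. mnorm M (s n - l)) \<longlonglongrightarrow> 0))"

definition hilbert_module ::
  "('h::chilbert_space \<Rightarrow>\<^sub>L 'h) set \<Rightarrow> ('h, 'm::complex_vector) hmodule \<Rightarrow> bool" where
  "hilbert_module A M \<longleftrightarrow> pre_hilbert_module A M \<and> mcomplete M"

text \<open>Maps between modules are functions on all of \<open>'m\<close>; only their values on the source module
  matter.\<close>

definition mod_linear ::
  "('h::chilbert_space \<Rightarrow>\<^sub>L 'h) set \<Rightarrow> ('h, 'm::complex_vector) hmodule \<Rightarrow> ('h, 'm) hmodule \<Rightarrow>
    ('m \<Rightarrow> 'm) \<Rightarrow> bool" where
  "mod_linear A M N L \<longleftrightarrow>
     (\<forall>u\<in>mcarrier M. \<forall>v\<in>mcarrier M. \<forall>z. L (z *\<^sub>C u + v) = z *\<^sub>C L u + L v) \<and>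
     (\<forall>u\<in>mcarrier M. \<forall>a\<in>A. L (mact M u a) = mact N (L u) a)"

definition mod_continuous ::
  "('h::real_normed_vector, 'm::complex_vector) hmodule \<Rightarrow> ('h, 'm) hmodule \<Rightarrow>
    ('m \<Rightarrow> 'm) \<Rightarrow> bool" where
  "mod_continuous M N L \<longleftrightarrow>
     (\<forall>u\<in>mcarrier M. \<forall>e>0. \<exists>d>0. \<forall>v\<in>mcarrier M.
        mnorm M (v - u) < d \<longrightarrow> mnorm N (L v - L u) < e)"

text \<open>\<open>is_adjoint M N L' L\<close> means that \<open>L' : N \<rightarrow> M\<close> is the adjoint \<open>L\<^sup>*\<close> of \<open>L : M \<rightarrow> N\<close>.\<close>

definition is_adjoint ::
  "('h::real_normed_vector, 'm) hmodule \<Rightarrow> ('h, 'm) hmodule \<Rightarrow> ('m \<Rightarrow> 'm) \<Rightarrow> ('m \<Rightarrow> 'm) \<Rightarrow> bool" where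
  "is_adjoint M N L' L \<longleftrightarrow>
     L' \<in> mcarrier N \<rightarrow> mcarrier M \<and>
     (\<forall>u\<in>mcarrier M. \<forall>v\<in>mcarrier N. mprod N (L u) v = mprod M u (L' v))"

definition morphism ::
  "('h::chilbert_space \<Rightarrow>\<^sub>L 'h) set \<Rightarrow> ('h, 'm::complex_vector) hmodule \<Rightarrow> ('h, 'm) hmodule \<Rightarrow>
    ('m \<Rightarrow> 'm) \<Rightarrow> bool" where
  "morphism A M N L \<longleftrightarrow>
     L \<in> mcarrier M \<rightarrow> mcarrier N \<and> mod_linear A M N L \<and> mod_continuous M N L \<and>
     (\<exists>L'. is_adjoint M N L' L)"

definition self_adjoint_morphism ::
  "('h::chilbert_space \<Rightarrow>\<^sub>L 'h) set \<Rightarrow> ('h, 'm::complex_vector) hmodule \<Rightarrow> ('m \<Rightarrow> 'm) \<Rightarrow> bool" where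
  "self_adjoint_morphism A M L \<longleftrightarrow> morphism A M M L \<and> is_adjoint M M L L"

definition op_norm ::
  "('h::real_normed_vector, 'm) hmodule \<Rightarrow> ('h, 'm) hmodule \<Rightarrow> ('m \<Rightarrow> 'm) \<Rightarrow> real" where
  "op_norm M N L = (SUP u\<in>{u\<in>mcarrier M. mnorm M u \<le> 1}. mnorm N (L u))"

definition elementary_op ::
  "('h::real_normed_vector, 'm) hmodule \<Rightarrow> ('h, 'm) hmodule \<Rightarrow> 'm \<Rightarrow> 'm \<Rightarrow> 'm \<Rightarrow> 'm" where
  "elementary_op M N u v = (\<lambda>u'. mact N v (mprod M u u'))"

text \<open>Sums of elementary operators suffice, because
  \<open>v \<cdot> (u, u')\<close> already absorbs a factor \<open>a \<in> A\<close>, replacing \<open>v\<close> by \<open>v \<cdot> a\<close>.\<close>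

definition finite_rank ::
  "('h::chilbert_space \<Rightarrow>\<^sub>L 'h) set \<Rightarrow> ('h, 'm::complex_vector) hmodule \<Rightarrow> ('h, 'm) hmodule \<Rightarrow>
    ('m \<Rightarrow> 'm) \<Rightarrow> bool" where
  "finite_rank A M N L \<longleftrightarrow>
     morphism A M N L \<and>
     (\<exists>(n::nat) us vs. us ` {..<n} \<subseteq> mcarrier M \<and> vs ` {..<n} \<subseteq> mcarrier N \<and>
        (\<forall>u'\<in>mcarrier M. L u' = (\<Sum>i<n. elementary_op M N (us i) (vs i) u')))"

definition compact_morphism ::
  "('h::chilbert_space \<Rightarrow>\<^sub>L 'h) set \<Rightarrow> ('h, 'm::complex_vector) hmodule \<Rightarrow> ('h, 'm) hmodule \<Rightarrow>
    ('m \<Rightarrow> 'm) \<Rightarrow> bool" where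
  "compact_morphism A M N L \<longleftrightarrow>
     morphism A M N L \<and>
     (\<forall>e>0. \<exists>F. finite_rank A M N F \<and> op_norm M N (\<lambda>u. L u - F u) < e)"

definition fredholm ::
  "('h::chilbert_space \<Rightarrow>\<^sub>L 'h) set \<Rightarrow> ('h, 'm::complex_vector) hmodule \<Rightarrow> ('h, 'm) hmodule \<Rightarrow>
    ('m \<Rightarrow> 'm) \<Rightarrow> bool" where
  "fredholm A M N F \<longleftrightarrow>
     morphism A M N F \<and>
     (\<exists>GM GN PM PN.
        morphism A N M GM \<and> morphism A N M GN \<and>
        compact_morphism A M M PM \<and> compact_morphism A N N PN \<and>
        (\<forall>u\<in>mcarrier M. GM (F u) = u + PM u) \<and>
        (\<forall>v\<in>mcarrier N. F (GN v) = v + PN v))"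

definition self_adjoint_parametrix_possessing ::
  "('h::chilbert_space \<Rightarrow>\<^sub>L 'h) set \<Rightarrow> ('h, 'm::complex_vector) hmodule \<Rightarrow> ('m \<Rightarrow> 'm) \<Rightarrow> bool" where
  "self_adjoint_parametrix_possessing A M F \<longleftrightarrow>
     self_adjoint_morphism A M F \<and>
     (\<exists>G P. morphism A M M G \<and> self_adjoint_morphism A M P \<and>
        (\<forall>u\<in>mcarrier M. u = G (F u) + P u) \<and>
        (\<forall>u\<in>mcarrier M. u = F (G u) + P u) \<and>
        (\<forall>u\<in>mcarrier M. F (P u) = 0))"

definition mod_kernel ::
  "('h::real_normed_vector, 'm::complex_vector) hmodule \<Rightarrow> ('m \<Rightarrow> 'm) \<Rightarrow> 'm set" where
  "mod_kernel M L = {u \<in> mcarrier M. L u = 0}"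

end

theory Submission
  imports Defs
begin

text \<open>
  For \<open>h\<close> in the Hilbert space, \<open>u \<mapsto> \<langle>h, (u,u) h\<rangle>\<^sup>1\<^sup>/\<^sup>2\<close> is a seminorm on a module, and the
  module norm is the supremum of these seminorms over unit vectors \<open>h\<close>. A compactness argument shows
  that a left Fredholm morphism \<open>F\<close> satisfies \<open>\<parallel>F z\<parallel>\<^sub>h \<ge> \<delta> \<parallel>z\<parallel>\<^sub>h\<close> for \<open>z\<close> in the range of
  \<open>F\<^sup>*\<close>, uniformly in \<open>h\<close>, because the coefficient algebra consists of compact operators. Hence
  \<open>\<Sum>\<^sub>k (1 - t F\<^sup>* F)\<^sup>k F\<^sup>* w\<close> converges geometrically, and \<open>F\<^sup>* F y = F\<^sup>* w\<close> has a solution \<open>y\<close>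
  bounded by a multiple of \<open>w\<close>. For \<open>F\<close> the extension of \<open>D\<close> this writes each \<open>u \<in> U\<close> as
  \<open>k + F y\<close> with \<open>F\<^sup>* k = 0\<close>, where \<open>k, y \<in> U\<close> by the regularity assumptions.

  The products and actions of \<open>U\<close>, \<open>V\<close>, \<open>W\<close> need not agree, only the norms of \<open>U\<close> and \<open>W\<close>
  do. So \<open>D k = 0\<close> is derived from norms: since \<open>k\<close> is orthogonal to the range of \<open>F\<close> in \<open>W\<close>,
  \<open>\<parallel>k + t D\<^sup>2 k\<parallel>\<^sup>2 \<le> \<parallel>k\<parallel>\<^sup>2 + t\<^sup>2 \<parallel>D\<^sup>2 k\<parallel>\<^sup>2\<close> for all \<open>t > 0\<close>, which in \<open>U\<close> forces \<open>D k = 0\<close>.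
  Thus \<open>U = Ker D \<oplus> D(U)\<close>, with \<open>P\<close> the projection onto the kernel and \<open>G\<close> the inverse of \<open>D\<close> on
  its range.
\<close>

section \<open>Real quadratics, inner products and compact operators\<close>

text \<open>The discriminant argument behind both Cauchy-Schwarz inequalities below. The case
  \<open>c = 0\<close> matters because the forms \<open>vform M h\<close> may be degenerate.\<close>

lemma quadratic_nonneg_imp:
  fixes a b c :: real
  assumes "\<And>t. 0 \<le> a + 2 * t * b + t\<^sup>2 * c" "0 \<le> a" "0 \<le> c"
  shows "\<bar>b\<bar> \<le> sqrt a * sqrt c"
proof -
  have "b\<^sup>2 \<le> a * c"
  proof (cases "c = 0")
    case True
    \<comment> \<open>With \<open>c = 0\<close> the quadratic is affine in \<open>t\<close>; the
      chosen \<open>t\<close> gives it the value -1.\<close>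
    have "b = 0"
    proof (rule ccontr)
      assume "b \<noteq> 0"
      then show False
        using assms(1)[of "- (a + 1) / (2 * b)"] True by (simp add: field_simps)
    qed
    then show ?thesis using True by simp
  next
    case False
    then have "0 < c" using assms(3) by simp
    \<comment> \<open>The minimum of the quadratic is at \<open>t = - b / c\<close>.\<close>
    then show ?thesis
      using assms(1)[of "- b / c"] by (simp add: field_simps power2_eq_square)
  qed
  then have "sqrt (b\<^sup>2) \<le> sqrt (a * c)" by (rule real_sqrt_le_mono)
  then show ?thesis by (simp add: real_sqrt_mult)
qed

lemma cinner_add_left: "cinner (x + y) z = cinner x z + cinner y z"
  using cinner_commute[of "x + y" z] cinner_commute[of x z] cinner_commute[of y z]
  by (simp add: cinner_add_right)

lemma Re_cinner_commute: "Re (cinner x y) = Re (cinner y x)"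
  by (subst cinner_commute) simp

lemma cinner_scaleR_right: "cinner x (r *\<^sub>R y) = of_real r * cinner x y"
  by (simp add: scaleR_scaleC cinner_scaleC_right)

lemma cinner_scaleR_left: "cinner (r *\<^sub>R x) y = of_real r * cinner x y"
  using cinner_commute[of "r *\<^sub>R x" y] cinner_commute[of x y] by (simp add: cinner_scaleR_right)

lemma cinner_zero_right [simp]: "cinner x 0 = 0"
  using cinner_add_right[of x 0 0] by simp

lemma cinner_diff_right: "cinner x (y - z) = cinner x y - cinner x z"
  using cinner_add_right[of x "y - z" z] by simp

lemma cinner_sum_right: "cinner x (\<Sum>i\<in>I. f i) = (\<Sum>i\<in>I. cinner x (f i))"
  by (induction I rule: infinite_finite_induct) (simp_all add: cinner_add_right)

lemma Re_cinner_self: "Re (cinner x x) = (norm x)\<^sup>2"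
  by (simp add: cinner_self)

lemma Re_cinner_bound: "\<bar>Re (cinner x y)\<bar> \<le> norm x * norm y"
proof -
  have "0 \<le> (norm x)\<^sup>2 + 2 * t * Re (cinner x y) + t\<^sup>2 * (norm y)\<^sup>2" for t
  proof -
    have "(norm (x + t *\<^sub>R y))\<^sup>2 = (norm x)\<^sup>2 + 2 * t * Re (cinner x y) + t\<^sup>2 * (norm y)\<^sup>2"
      unfolding Re_cinner_self[symmetric]
      by (simp add: cinner_add_left cinner_add_right cinner_scaleR_left cinner_scaleR_right
          Re_cinner_commute[of y x] power2_eq_square algebra_simps)
    then show ?thesis by (metis zero_le_power2)
  qed
  from quadratic_nonneg_imp[OF this] show ?thesis by simp
qed

lemma cinner_eq_imp_eq:
  assumes "\<And>x. cinner x y = cinner x z"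
  shows "y = z"
proof -
  have "cinner (y - z) (y - z) = 0"
    using assms[of "y - z"] by (simp add: cinner_diff_right)
  then show ?thesis by (simp add: cinner_self)
qed

lemma is_adjoint_op_unique: "is_adjoint_op b a \<Longrightarrow> is_adjoint_op b' a \<Longrightarrow> b = b'"
  unfolding is_adjoint_op_def by (intro blinfun_eqI cinner_eq_imp_eq) metis

text \<open>Since \<open>compact_op\<close> speaks of the unit ball only, the sequence is scaled
  into it and the limit is scaled back; the maximum with 1 keeps the divisor positive for every
  \<open>K\<close>.\<close>

lemma compact_op_subseq:
  fixes x :: "nat \<Rightarrow> 'h::real_normed_vector"
  assumes "compact_op a" and bd: "\<And>m. norm (x m) \<le> K"
  obtains r l where "strict_mono r" "(\<lambda>m. blinfun_apply a (x (r m))) \<longlonglongrightarrow> l"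
proof -
  define c where "c = max K 1"
  have c: "c > 0" by (simp add: c_def)
  have "x m /\<^sub>R c \<in> cball 0 1" for m
    using bd[of m] c by (simp add: c_def field_simps)
  then have "blinfun_apply a (x m /\<^sub>R c) \<in> closure (blinfun_apply a ` cball 0 1)" for m
    using closure_subset by blast
  moreover have "seq_compact (closure (blinfun_apply a ` cball 0 1))"
    using assms(1) by (simp add: compact_op_def compact_eq_seq_compact_metric)
  ultimately obtain l r where r: "strict_mono r"
    and l: "((\<lambda>m. blinfun_apply a (x m /\<^sub>R c)) \<circ> r) \<longlonglongrightarrow> l"
    by (metis seq_compactE[where f = "\<lambda>m. blinfun_apply a (x m /\<^sub>R c)"])
  have "(\<lambda>m. c *\<^sub>R blinfun_apply a (x (r m) /\<^sub>R c)) \<longlonglongrightarrow> c *\<^sub>R l"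
    using l by (intro tendsto_intros) (simp add: o_def)
  then have "(\<lambda>m. blinfun_apply a (x (r m))) \<longlonglongrightarrow> c *\<^sub>R l"
    using c by (simp add: blinfun.scaleR_right)
  with r show ?thesis by (rule that)
qed

text \<open>Each further operator costs one more passage to a subsequence, under which the
  convergence already reached survives.\<close>

lemma compact_op_family_subseq:
  fixes x :: "'i \<Rightarrow> nat \<Rightarrow> 'h::real_normed_vector"
  assumes "finite I" "\<And>i. i \<in> I \<Longrightarrow> compact_op (a i)" "\<And>i m. i \<in> I \<Longrightarrow> norm (x i m) \<le> K i"
  shows "\<exists>r. strict_mono r \<and> (\<forall>i\<in>I. convergent (\<lambda>m. blinfun_apply (a i) (x i (r m))))"
  using assms
proof (induction I rule: finite_induct)
  case empty
  show ?case by (auto intro: exI[of _ id] strict_mono_id)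
next
  case (insert i I)
  then obtain r where r: "strict_mono r"
    and conv: "\<And>j. j \<in> I \<Longrightarrow> convergent (\<lambda>m. blinfun_apply (a j) (x j (r m)))"
    by auto
  obtain s l where s: "strict_mono s" and l: "(\<lambda>m. blinfun_apply (a i) (x i (r (s m)))) \<longlonglongrightarrow> l"
    using compact_op_subseq[of "a i" "\<lambda>m. x i (r m)" "K i"] insert.prems by auto
  have "convergent (\<lambda>m. blinfun_apply (a j) (x j (r (s m))))" if "j \<in> I" for j
    using convergent_subseq_convergent[OF conv[OF that] s] by (simp add: o_def)
  moreover have "convergent (\<lambda>m. blinfun_apply (a i) (x i (r (s m))))"
    using l by (rule convergentI)
  ultimately show ?case
    using strict_mono_o[OF r s] by (intro exI[of _ "r \<circ> s"]) (auto simp: o_def)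
qed

subsection \<open>The seminorms of a pre-Hilbert module\<close>

text \<open>This is the real part of the inner product of \<open>u \<otimes> h\<close> and
  \<open>v \<otimes> h\<close> in the Hilbert space \<open>M \<otimes>\<^sub>A H\<close>;
  accordingly \<open>vnorm\<close> is the norm of \<open>u \<otimes> h\<close>, a seminorm in
  \<open>u\<close>. Real parts give a real symmetric form, which is enough for norm
  estimates.\<close>

definition vform ::
  "('h::complex_inner, 'm) hmodule \<Rightarrow> 'h \<Rightarrow> 'm \<Rightarrow> 'm \<Rightarrow> real" where
  "vform M h u v = Re (cinner h (blinfun_apply (mprod M u v) h))"

definition vnorm :: "('h::complex_inner, 'm) hmodule \<Rightarrow> 'h \<Rightarrow> 'm \<Rightarrow> real" where
  "vnorm M h u = sqrt (vform M h u u)"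

locale pre_hilbert_over =
  fixes A :: "('h::chilbert_space \<Rightarrow>\<^sub>L 'h) set" and M :: "('h, 'm::complex_vector) hmodule"
  assumes cstar: "cstar_compact A" and pre_hilbert: "pre_hilbert_module A M"
begin

lemma right_module: "right_module A M"
  using pre_hilbert by (simp add: pre_hilbert_module_def)

lemma subspace: "csubspace (mcarrier M)"
  using right_module by (simp add: right_module_def)

lemma zero_mem [simp, intro]: "0 \<in> mcarrier M"
  using subspace by (rule complex_vector.subspace_0)

lemma add_mem [simp, intro]: "u \<in> mcarrier M \<Longrightarrow> v \<in> mcarrier M \<Longrightarrow> u + v \<in> mcarrier M"
  using subspace by (rule complex_vector.subspace_add)

lemma diff_mem [simp, intro]: "u \<in> mcarrier M \<Longrightarrow> v \<in> mcarrier M \<Longrightarrow> u - v \<in> mcarrier M"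
  using subspace by (rule complex_vector.subspace_diff)

lemma scaleC_mem [simp, intro]: "u \<in> mcarrier M \<Longrightarrow> z *\<^sub>C u \<in> mcarrier M"
  using subspace by (rule complex_vector.subspace_scale)

lemma scaleR_mem [simp, intro]: "u \<in> mcarrier M \<Longrightarrow> r *\<^sub>R u \<in> mcarrier M"
  by (simp add: scaleR_scaleC)

lemma sum_mem [intro]: "(\<And>i. i \<in> I \<Longrightarrow> f i \<in> mcarrier M) \<Longrightarrow> sum f I \<in> mcarrier M"
  using subspace by (rule complex_vector.subspace_sum)

lemma act_mem [simp, intro]: "u \<in> mcarrier M \<Longrightarrow> a \<in> A \<Longrightarrow> mact M u a \<in> mcarrier M"
  using right_module by (simp add: right_module_def)

lemma act_add: "u \<in> mcarrier M \<Longrightarrow> v \<in> mcarrier M \<Longrightarrow> a \<in> A \<Longrightarrow>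
    mact M (u + v) a = mact M u a + mact M v a"
  using right_module by (simp add: right_module_def)

lemma act_zero [simp]: "a \<in> A \<Longrightarrow> mact M 0 a = 0"
  using act_add[of 0 0 a] by simp

lemma prod_mem [simp, intro]: "u \<in> mcarrier M \<Longrightarrow> v \<in> mcarrier M \<Longrightarrow> mprod M u v \<in> A"
  using pre_hilbert by (simp add: pre_hilbert_module_def)

lemma prod_compact: "u \<in> mcarrier M \<Longrightarrow> v \<in> mcarrier M \<Longrightarrow> compact_op (mprod M u v)"
  using prod_mem[of u v] cstar by (auto simp: cstar_compact_def compact_operators_def)

lemma prod_linear: "u \<in> mcarrier M \<Longrightarrow> v \<in> mcarrier M \<Longrightarrow> w \<in> mcarrier M \<Longrightarrow>
    mprod M u (z *\<^sub>C v + w) = z *\<^sub>C mprod M u v + mprod M u w"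
  using pre_hilbert by (simp add: pre_hilbert_module_def)

lemma prod_add_right: "u \<in> mcarrier M \<Longrightarrow> v \<in> mcarrier M \<Longrightarrow> w \<in> mcarrier M \<Longrightarrow>
    mprod M u (v + w) = mprod M u v + mprod M u w"
  using prod_linear[of u v w 1] by simp

lemma prod_zero_right [simp]: "u \<in> mcarrier M \<Longrightarrow> mprod M u 0 = 0"
  using prod_add_right[of u 0 0] by simp

lemma prod_scaleR_right: "u \<in> mcarrier M \<Longrightarrow> v \<in> mcarrier M \<Longrightarrow>
    mprod M u (r *\<^sub>R v) = r *\<^sub>R mprod M u v"
  using prod_linear[of u v 0 "of_real r"] by (simp add: scaleR_scaleC)

lemma prod_sum_right: "u \<in> mcarrier M \<Longrightarrow> (\<And>i. i \<in> I \<Longrightarrow> f i \<in> mcarrier M) \<Longrightarrow>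
    mprod M u (sum f I) = (\<Sum>i\<in>I. mprod M u (f i))"
  by (induction I rule: infinite_finite_induct) (simp_all add: prod_add_right sum_mem)

lemma prod_act: "u \<in> mcarrier M \<Longrightarrow> v \<in> mcarrier M \<Longrightarrow> a \<in> A \<Longrightarrow>
    mprod M u (mact M v a) = mprod M u v o\<^sub>L a"
  using pre_hilbert by (simp add: pre_hilbert_module_def)

lemma prod_adjoint: "u \<in> mcarrier M \<Longrightarrow> v \<in> mcarrier M \<Longrightarrow>
    is_adjoint_op (mprod M u v) (mprod M v u)"
  using pre_hilbert by (simp add: pre_hilbert_module_def)

lemma prod_swap: "u \<in> mcarrier M \<Longrightarrow> v \<in> mcarrier M \<Longrightarrow>
    cinner x (blinfun_apply (mprod M u v) y) = cinner (blinfun_apply (mprod M v u) x) y"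
  using prod_adjoint[of u v] by (simp add: is_adjoint_op_def)

lemma prod_add_left:
  assumes "u \<in> mcarrier M" "v \<in> mcarrier M" "w \<in> mcarrier M"
  shows "mprod M (u + v) w = mprod M u w + mprod M v w"
proof (rule is_adjoint_op_unique)
  show "is_adjoint_op (mprod M (u + v) w) (mprod M w (u + v))"
    using assms by (simp add: prod_adjoint)
  show "is_adjoint_op (mprod M u w + mprod M v w) (mprod M w (u + v))"
    using assms
    by (simp add: is_adjoint_op_def prod_add_right blinfun.add_left cinner_add_left cinner_add_right
        prod_swap)
qed

lemma prod_zero_left [simp]: "u \<in> mcarrier M \<Longrightarrow> mprod M 0 u = 0"
  using prod_add_left[of 0 0 u] by simp

lemma vform_sym: "u \<in> mcarrier M \<Longrightarrow> v \<in> mcarrier M \<Longrightarrow> vform M h u v = vform M h v u"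
  by (simp add: vform_def prod_swap[of u v]) (rule Re_cinner_commute)

lemma vform_add_right: "u \<in> mcarrier M \<Longrightarrow> v \<in> mcarrier M \<Longrightarrow> w \<in> mcarrier M \<Longrightarrow>
    vform M h u (v + w) = vform M h u v + vform M h u w"
  by (simp add: vform_def prod_add_right blinfun.add_left cinner_add_right)

lemma vform_scaleR_right: "u \<in> mcarrier M \<Longrightarrow> v \<in> mcarrier M \<Longrightarrow>
    vform M h u (r *\<^sub>R v) = r * vform M h u v"
  by (simp add: vform_def prod_scaleR_right blinfun.scaleR_left cinner_scaleR_right)

lemma vform_diff_right: "u \<in> mcarrier M \<Longrightarrow> v \<in> mcarrier M \<Longrightarrow> w \<in> mcarrier M \<Longrightarrow>
    vform M h u (v - w) = vform M h u v - vform M h u w"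
  using vform_add_right[of u "v - w" w h] by simp

lemma vform_zero [simp]: "u \<in> mcarrier M \<Longrightarrow> vform M h u 0 = 0" "u \<in> mcarrier M \<Longrightarrow> vform M h 0 u = 0"
  by (simp_all add: vform_def)

lemma vform_nonneg: "u \<in> mcarrier M \<Longrightarrow> 0 \<le> vform M h u u"
  using pre_hilbert
  by (auto simp: pre_hilbert_module_def positive_op_def vform_def complex_nonneg_Reals_iff)

lemma vnorm_nonneg [simp]: "u \<in> mcarrier M \<Longrightarrow> 0 \<le> vnorm M h u"
  by (simp add: vnorm_def vform_nonneg)

lemma vnorm_square: "u \<in> mcarrier M \<Longrightarrow> (vnorm M h u)\<^sup>2 = vform M h u u"
  by (simp add: vnorm_def vform_nonneg)

lemma vnorm_add_square:
  assumes "u \<in> mcarrier M" "v \<in> mcarrier M"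
  shows "(vnorm M h (u + t *\<^sub>R v))\<^sup>2 =
    (vnorm M h u)\<^sup>2 + 2 * t * vform M h u v + t\<^sup>2 * (vnorm M h v)\<^sup>2"
proof -
  have "vform M h (u + t *\<^sub>R v) (u + t *\<^sub>R v) =
      vform M h (u + t *\<^sub>R v) u + t * vform M h (u + t *\<^sub>R v) v"
    using assms by (simp add: vform_add_right vform_scaleR_right)
  also have "vform M h (u + t *\<^sub>R v) u = vform M h u u + t * vform M h u v"
    using assms by (subst vform_sym) (simp_all add: vform_add_right vform_scaleR_right)
  also have "vform M h (u + t *\<^sub>R v) v = vform M h u v + t * vform M h v v"
    using assms
    by (subst vform_sym) (simp_all add: vform_add_right vform_scaleR_right vform_sym[of v u])
  finally show ?thesis
    using assms by (simp only: vnorm_square add_mem scaleR_mem) (simp add: power2_eq_square algebra_simps)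
qed

lemma vform_bound:
  assumes "u \<in> mcarrier M" "v \<in> mcarrier M"
  shows "\<bar>vform M h u v\<bar> \<le> vnorm M h u * vnorm M h v"
proof -
  have "0 \<le> (vnorm M h u)\<^sup>2 + 2 * t * vform M h u v + t\<^sup>2 * (vnorm M h v)\<^sup>2" for t
    using vnorm_add_square[OF assms, of h t] by (metis zero_le_power2)
  from quadratic_nonneg_imp[OF this] show ?thesis
    using assms by simp
qed

lemma vnorm_triangle:
  assumes "u \<in> mcarrier M" "v \<in> mcarrier M"
  shows "vnorm M h (u + v) \<le> vnorm M h u + vnorm M h v"
proof (rule power2_le_imp_le)
  show "(vnorm M h (u + v))\<^sup>2 \<le> (vnorm M h u + vnorm M h v)\<^sup>2"
    using vnorm_add_square[OF assms, of h 1] vform_bound[OF assms, of h]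
    by (simp add: power2_sum)
  show "0 \<le> vnorm M h u + vnorm M h v" using assms by simp
qed

lemma vnorm_scaleR: "u \<in> mcarrier M \<Longrightarrow> vnorm M h (r *\<^sub>R u) = \<bar>r\<bar> * vnorm M h u"
  using vform_sym[of "r *\<^sub>R u" u h]
  by (simp add: vnorm_def vform_scaleR_right real_sqrt_mult mult.assoc[symmetric])

lemma vnorm_triangle_diff:
  assumes "u \<in> mcarrier M" "v \<in> mcarrier M"
  shows "vnorm M h (u - v) \<le> vnorm M h u + vnorm M h v"
  using vnorm_triangle[of u "(- 1) *\<^sub>R v" h] vnorm_scaleR[of v h "- 1"] assms
    scaleR_mem[of v "- 1"] by simp

text \<open>In tensor notation \<open>u a \<otimes> h = u \<otimes> a h\<close>: an action on the
  module is traded for a change of the vector.\<close>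

lemma vnorm_act:
  assumes "u \<in> mcarrier M" "a \<in> A"
  shows "vnorm M h (mact M u a) = vnorm M (blinfun_apply a h) u"
proof -
  have "vform M h (mact M u a) (mact M u a) = vform M (blinfun_apply a h) u u"
    using assms prod_swap[of "mact M u a" u h "blinfun_apply a h"]
    by (simp add: vform_def prod_act) (rule Re_cinner_commute[THEN trans], simp add: prod_swap[symmetric])
  then show ?thesis by (simp add: vnorm_def)
qed

text \<open>As \<open>(v,u)\<close> is the adjoint of \<open>(u,v)\<close>, the left side is the
  value of \<open>vform M h\<close> at \<open>v\<close> and \<open>u \<cdot> (u,v)\<close>, to which
  Cauchy-Schwarz for the fixed \<open>h\<close> applies.\<close>

lemma norm_prod_square:
  assumes "u \<in> mcarrier M" "v \<in> mcarrier M"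
  shows "(norm (blinfun_apply (mprod M u v) h))\<^sup>2 \<le>
    vnorm M h v * vnorm M (blinfun_apply (mprod M u v) h) u"
proof -
  let ?a = "mprod M u v"
  have "(norm (blinfun_apply ?a h))\<^sup>2 = vform M h v (mact M u ?a)"
    using assms prod_swap[of v u h "blinfun_apply ?a h"]
    by (simp add: Re_cinner_self[symmetric] vform_def prod_act)
  also have "\<dots> \<le> vnorm M h v * vnorm M h (mact M u ?a)"
    using vform_bound[of v "mact M u ?a" h] assms by simp
  finally show ?thesis using assms by (simp add: vnorm_act)
qed

lemma mnorm_nonneg [simp]: "0 \<le> mnorm M u"
  by (simp add: mnorm_def)

lemma vnorm_le_mnorm:
  assumes "u \<in> mcarrier M"
  shows "vnorm M h u \<le> mnorm M u * norm h"
proof -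
  have "vform M h u u \<le> norm h * norm (blinfun_apply (mprod M u u) h)"
    using Re_cinner_bound[of h "blinfun_apply (mprod M u u) h"] by (simp add: vform_def)
  also have "\<dots> \<le> norm h * (norm (mprod M u u) * norm h)"
    by (intro mult_left_mono norm_blinfun) simp
  finally have "sqrt (vform M h u u) \<le> sqrt (norm (mprod M u u) * (norm h)\<^sup>2)"
    by (intro real_sqrt_le_mono) (simp add: power2_eq_square mult_ac)
  then show ?thesis by (simp add: vnorm_def mnorm_def real_sqrt_mult)
qed

text \<open>A mixed Cauchy-Schwarz inequality: only one factor becomes a module norm, so that
  smallness of \<open>v\<close> at a single vector \<open>h\<close> is not lost.\<close>

lemma norm_prod_le:
  assumes "u \<in> mcarrier M" "v \<in> mcarrier M"
  shows "norm (blinfun_apply (mprod M u v) h) \<le> mnorm M u * vnorm M h v"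
proof (cases "blinfun_apply (mprod M u v) h = 0")
  case True
  then show ?thesis using assms by simp
next
  case False
  let ?n = "norm (blinfun_apply (mprod M u v) h)"
  have "?n * ?n \<le> vnorm M h v * vnorm M (blinfun_apply (mprod M u v) h) u"
    using norm_prod_square[OF assms, of h] by (simp add: power2_eq_square)
  also have "\<dots> \<le> vnorm M h v * (mnorm M u * ?n)"
    using assms by (intro mult_left_mono vnorm_le_mnorm) simp_all
  finally have "?n * ?n \<le> (mnorm M u * vnorm M h v) * ?n" by (simp add: mult_ac)
  then show ?thesis using False by simp
qed

text \<open>The way back from the seminorms to the module norm. For \<open>u = v\<close>,
  \<open>norm_prod_square\<close> bounds the square of the norm of \<open>(u,u) h\<close> by
  \<open>c\<^sup>2 * norm h\<close> times that norm, and one factor cancels.\<close>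

lemma mnorm_leI:
  assumes "u \<in> mcarrier M" "0 \<le> c" "\<And>h. vnorm M h u \<le> c * norm h"
  shows "mnorm M u \<le> c"
proof -
  have "norm (mprod M u u) \<le> c\<^sup>2"
  proof (rule norm_blinfun_bound)
    fix h
    let ?n = "norm (blinfun_apply (mprod M u u) h)"
    have "?n * ?n \<le> vnorm M h u * vnorm M (blinfun_apply (mprod M u u) h) u"
      using norm_prod_square[of u u h] assms(1) by (simp add: power2_eq_square)
    also have "\<dots> \<le> (c * norm h) * (c * ?n)"
      using assms by (intro mult_mono) simp_all
    finally have "?n * ?n \<le> (c\<^sup>2 * norm h) * ?n" by (simp add: power2_eq_square mult_ac)
    then show "?n \<le> c\<^sup>2 * norm h"
      by (cases "?n = 0") simp_all
  qed simp
  then have "sqrt (norm (mprod M u u)) \<le> sqrt (c\<^sup>2)" by (rule real_sqrt_le_mono)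
  then show ?thesis using assms(2) by (simp add: mnorm_def)
qed

lemma mnorm_eq_0: "u \<in> mcarrier M \<Longrightarrow> mnorm M u = 0 \<Longrightarrow> u = 0"
  using pre_hilbert by (simp add: pre_hilbert_module_def mnorm_def)

lemma mnorm_zero [simp]: "mnorm M 0 = 0"
  by (simp add: mnorm_def)

lemma eq_0I:
  assumes "u \<in> mcarrier M" "\<And>h. vform M h u u = 0"
  shows "u = 0"
proof (rule mnorm_eq_0)
  have "mnorm M u \<le> 0"
    using assms by (intro mnorm_leI) (simp_all add: vnorm_def)
  then show "mnorm M u = 0" using mnorm_nonneg[of u] by linarith
qed (rule assms(1))

lemma eqI:
  assumes "u \<in> mcarrier M" "v \<in> mcarrier M"
    "\<And>h w. w \<in> mcarrier M \<Longrightarrow> vform M h w u = vform M h w v"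
  shows "u = v"
proof -
  have "u - v = 0"
    using assms by (intro eq_0I) (simp_all add: vform_diff_right)
  then show ?thesis by simp
qed

lemma mnorm_triangle:
  assumes "u \<in> mcarrier M" "v \<in> mcarrier M"
  shows "mnorm M (u + v) \<le> mnorm M u + mnorm M v"
proof (rule mnorm_leI)
  fix h
  have "vnorm M h (u + v) \<le> vnorm M h u + vnorm M h v"
    using assms by (rule vnorm_triangle)
  also have "\<dots> \<le> mnorm M u * norm h + mnorm M v * norm h"
    using assms by (intro add_mono vnorm_le_mnorm)
  finally show "vnorm M h (u + v) \<le> (mnorm M u + mnorm M v) * norm h"
    by (simp add: algebra_simps)
qed (use assms in simp_all)

lemma mnorm_scaleR:
  assumes "u \<in> mcarrier M"
  shows "mnorm M (r *\<^sub>R u) = \<bar>r\<bar> * mnorm M u"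
proof -
  have "mprod M (r *\<^sub>R u) (r *\<^sub>R u) = r *\<^sub>R mprod M (r *\<^sub>R u) u"
    using assms by (simp add: prod_scaleR_right)
  \<comment> \<open>Linearity is part of the axioms in the second argument only; in the first it
    comes from the uniqueness of operator adjoints.\<close>
  also have "mprod M (r *\<^sub>R u) u = r *\<^sub>R mprod M u u"
  proof (rule is_adjoint_op_unique)
    show "is_adjoint_op (mprod M (r *\<^sub>R u) u) (mprod M u (r *\<^sub>R u))"
      using assms by (simp add: prod_adjoint)
    show "is_adjoint_op (r *\<^sub>R mprod M u u) (mprod M u (r *\<^sub>R u))"
      using assms by (simp add: is_adjoint_op_def prod_scaleR_right blinfun.scaleR_left
          cinner_scaleR_left cinner_scaleR_right prod_swap)
  qed
  finally show ?thesis
    by (simp add: mnorm_def real_sqrt_mult mult.assoc[symmetric])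
qed

lemma mnorm_minus: "u \<in> mcarrier M \<Longrightarrow> mnorm M (- u) = mnorm M u"
  using mnorm_scaleR[of u "- 1"] by simp

lemma mnorm_diff_commute: "u \<in> mcarrier M \<Longrightarrow> v \<in> mcarrier M \<Longrightarrow> mnorm M (u - v) = mnorm M (v - u)"
  using mnorm_minus[of "u - v"] by simp

lemma mnorm_triangle_diff:
  assumes "u \<in> mcarrier M" "v \<in> mcarrier M"
  shows "mnorm M (u - v) \<le> mnorm M u + mnorm M v"
  using mnorm_triangle[of u "(- 1) *\<^sub>R v"] mnorm_scaleR[of v "- 1"] assms
    scaleR_mem[of v "- 1"] by simp

lemma mnorm_sum:
  assumes "finite I" "\<And>i. i \<in> I \<Longrightarrow> f i \<in> mcarrier M"
  shows "mnorm M (sum f I) \<le> (\<Sum>i\<in>I. mnorm M (f i))"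
  using assms
proof (induction I rule: finite_induct)
  case (insert i I)
  then show ?case
    using mnorm_triangle[of "f i" "sum f I"] by (simp add: sum_mem)
qed simp

end

section \<open>Log-convex sequences and geometric series\<close>

text \<open>The ratios of a log-convex sequence do not decrease, so a first ratio
  \<open>p > q\<close> would force growth like \<open>p ^ n\<close>, against the bound
  \<open>C * q ^ n\<close>.\<close>

lemma log_convex_bound:
  fixes b :: "nat \<Rightarrow> real"
  assumes nonneg: "\<And>n. 0 \<le> b n" and conv: "\<And>n. (b (Suc n))\<^sup>2 \<le> b n * b (Suc (Suc n))"
    and bd: "\<And>n. b n \<le> C * q ^ n" and q: "0 \<le> q"
  shows "b 1 \<le> q * b 0"
proof (rule ccontr)
  assume neg: "\<not> b 1 \<le> q * b 0"
  have b0: "b 0 > 0"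
  proof (rule ccontr)
    assume "\<not> b 0 > 0"
    then have "b 0 = 0" using nonneg[of 0] by simp
    then have "b 1 = 0" using conv[of 0] by simp
    with neg \<open>b 0 = 0\<close> show False by simp
  qed
  define p where "p = b 1 / b 0"
  have p: "q < p" using neg b0 by (simp add: p_def field_simps)
  \<comment> \<open>Positivity is carried through the induction because its last step cancels the
    factor \<open>b n\<close>.\<close>
  have growth: "0 < b n \<and> p * b n \<le> b (Suc n)" for n
  proof (induction n)
    case 0
    show ?case using b0 by (simp add: p_def)
  next
    case (Suc n)
    have "0 < p * b n" using Suc p q by simp
    then have pos: "0 < b (Suc n)" using Suc by linarith
    have "(p * b n) * b (Suc n) \<le> b (Suc n) * b (Suc n)"
      using Suc pos by (intro mult_right_mono) auto
    also have "\<dots> \<le> b n * b (Suc (Suc n))"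
      using conv[of n] by (simp add: power2_eq_square)
    finally have "b n * (p * b (Suc n)) \<le> b n * b (Suc (Suc n))" by (simp add: mult_ac)
    then show ?case using Suc pos by simp
  qed
  have lower: "b 0 * p ^ n \<le> b n" for n
  proof (induction n)
    case (Suc n)
    have "b 0 * p ^ Suc n = p * (b 0 * p ^ n)" by simp
    also have "\<dots> \<le> p * b n" using Suc p q by (intro mult_left_mono) auto
    also have "\<dots> \<le> b (Suc n)" using growth by simp
    finally show ?case .
  qed simp
  show False
  \<comment> \<open>The comparison of powers divides by \<open>q\<close>; for \<open>q = 0\<close>
    the bound at index 1 already contradicts \<open>b 1 > 0\<close>.\<close>
  proof (cases "q = 0")
    case True
    then show False using bd[of 1] growth[of 1] by simp
  next
    case False
    then have "q > 0" using q by simp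
    have "1 < p / q" using p \<open>q > 0\<close> by simp
    then obtain n where n: "C / b 0 < (p / q) ^ n" using real_arch_pow by blast
    have "b 0 * p ^ n \<le> C * q ^ n" using lower[of n] bd[of n] by linarith
    then have "(p / q) ^ n \<le> C / b 0"
      using b0 \<open>q > 0\<close> by (simp add: power_divide field_simps)
    with n show False by simp
  qed
qed

context pre_hilbert_over
begin

text \<open>The increments of the partial sums \<open>s\<close> are dominated by those of the scalar
  geometric series \<open>t\<close>; this makes \<open>s\<close> Cauchy and bounds its
  limit.\<close>

lemma summable_geometric:
  assumes complete: "mcomplete M" and mem: "\<And>k. z k \<in> mcarrier M"
    and bd: "\<And>k. mnorm M (z k) \<le> C * \<rho> ^ k" and \<rho>: "0 \<le> \<rho>" "\<rho> < 1"
  shows "\<exists>y\<in>mcarrier M. (\<lambda>n. mnorm M ((\<Sum>k<n. z k) - y)) \<longlonglongrightarrow> 0 \<and> mnorm M y \<le> C / (1 - \<rho>)"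
proof -
  define s where "s n = (\<Sum>k<n. z k)" for n
  define t where "t n = (\<Sum>k<n. C * \<rho> ^ k)" for n
  have s_mem: "s n \<in> mcarrier M" for n
    unfolding s_def using mem by (intro sum_mem)
  have t_lim: "t \<longlonglongrightarrow> C / (1 - \<rho>)"
    using sums_mult[OF geometric_sums[of \<rho>], of C] \<rho> unfolding t_def sums_def by simp
  have step: "mnorm M (s n - s m) \<le> t n - t m" if "m \<le> n" for m n
  proof -
    have "s n - s m = (\<Sum>k\<in>{m..<n}. z k)" "t n - t m = (\<Sum>k\<in>{m..<n}. C * \<rho> ^ k)"
      using sum_diff_nat_ivl[of 0 m n z] sum_diff_nat_ivl[of 0 m n "\<lambda>k. C * \<rho> ^ k"] that
      by (simp_all add: s_def t_def lessThan_atLeast0)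
    moreover have "mnorm M (\<Sum>k\<in>{m..<n}. z k) \<le> (\<Sum>k\<in>{m..<n}. mnorm M (z k))"
      using mem by (intro mnorm_sum) simp_all
    moreover have "\<dots> \<le> (\<Sum>k\<in>{m..<n}. C * \<rho> ^ k)"
      using bd by (intro sum_mono)
    ultimately show ?thesis by simp
  qed
  have step': "mnorm M (s n - s m) \<le> \<bar>t n - t m\<bar>" for m n
    using step[of m n] step[of n m] mnorm_diff_commute[OF s_mem s_mem, of n m]
    by (cases "m \<le> n") auto
  have "\<exists>N. \<forall>m\<ge>N. \<forall>n\<ge>N. mnorm M (s m - s n) < e" if e: "e > 0" for e
  proof -
    obtain N where N: "\<forall>m\<ge>N. \<forall>n\<ge>N. norm (t m - t n) < e"
      using CauchyD[OF LIMSEQ_imp_Cauchy[OF t_lim] e] by blast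
    have "mnorm M (s m - s n) < e" if "m \<ge> N" "n \<ge> N" for m n
    proof -
      have "\<bar>t m - t n\<bar> < e" using N that by simp
      then show ?thesis using step'[of m n] by simp
    qed
    then show ?thesis by blast
  qed
  moreover have "range s \<subseteq> mcarrier M" using s_mem by blast
  ultimately have "range s \<subseteq> mcarrier M \<and> (\<forall>e>0. \<exists>N. \<forall>m\<ge>N. \<forall>n\<ge>N. mnorm M (s m - s n) < e)"
    by blast
  from mp[OF spec[OF complete[unfolded mcomplete_def]] this]
  obtain y where y: "y \<in> mcarrier M" and lim: "(\<lambda>n. mnorm M (s n - y)) \<longlonglongrightarrow> 0"
    by blast
  have y_le: "mnorm M y \<le> mnorm M (s n - y) + t n" for n
    using mnorm_triangle_diff[of "s n" "s n - y"] s_mem[of n] y step[of 0 n]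
    by (simp add: s_def t_def)
  have "(\<lambda>n. mnorm M (s n - y) + t n) \<longlonglongrightarrow> 0 + C / (1 - \<rho>)"
    using lim t_lim by (rule tendsto_add)
  then have "mnorm M y \<le> 0 + C / (1 - \<rho>)"
    by (rule LIMSEQ_le_const) (use y_le in blast)
  with y lim show ?thesis unfolding s_def by (intro bexI[of _ y] conjI) simp_all
qed

end

subsection \<open>Adjointable maps\<close>

locale pre_hilbert_pair = M: pre_hilbert_over A M + N: pre_hilbert_over A N
  for A :: "('h::chilbert_space \<Rightarrow>\<^sub>L 'h) set" and M N :: "('h, 'm::complex_vector) hmodule"
begin

context
  fixes L
  assumes lin: "mod_linear A M N L"
begin

lemma linear_add: "u \<in> mcarrier M \<Longrightarrow> v \<in> mcarrier M \<Longrightarrow> L (u + v) = L u + L v"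
  using lin unfolding mod_linear_def by (metis complex_vector.scale_one)

lemma linear_zero: "L 0 = 0"
  using linear_add[of 0 0] by simp

lemma linear_scaleC: "u \<in> mcarrier M \<Longrightarrow> L (z *\<^sub>C u) = z *\<^sub>C L u"
  using lin linear_zero M.zero_mem unfolding mod_linear_def by (metis add.right_neutral)

lemma linear_scaleR: "u \<in> mcarrier M \<Longrightarrow> L (r *\<^sub>R u) = r *\<^sub>R L u"
  by (simp add: scaleR_scaleC linear_scaleC)

lemma linear_diff: "u \<in> mcarrier M \<Longrightarrow> v \<in> mcarrier M \<Longrightarrow> L (u - v) = L u - L v"
  using linear_add[of "u - v" v] by simp

lemma linear_sum:
  "(\<And>i. i \<in> I \<Longrightarrow> f i \<in> mcarrier M) \<Longrightarrow> L (sum f I) = (\<Sum>i\<in>I. L (f i))"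
  by (induction I rule: infinite_finite_induct) (simp_all add: linear_zero linear_add M.sum_mem)

lemma linear_act: "u \<in> mcarrier M \<Longrightarrow> a \<in> A \<Longrightarrow> L (mact M u a) = mact N (L u) a"
  using lin by (simp add: mod_linear_def)

lemma bounded_imp_continuous:
  assumes bd: "\<And>u. u \<in> mcarrier M \<Longrightarrow> mnorm N (L u) \<le> K * mnorm M u"
  shows "mod_continuous M N L"
  unfolding mod_continuous_def
proof (intro ballI allI impI)
  fix u and e :: real assume u: "u \<in> mcarrier M" and e: "e > 0"
  define d where "d = e / (\<bar>K\<bar> + 1)"
  have "mnorm N (L v - L u) < e" if v: "v \<in> mcarrier M" "mnorm M (v - u) < d" for v
  proof -
    have "mnorm N (L v - L u) \<le> K * mnorm M (v - u)"
      using bd[of "v - u"] u v by (simp add: linear_diff)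
    also have "\<dots> \<le> (\<bar>K\<bar> + 1) * mnorm M (v - u)"
      by (intro mult_right_mono) simp_all
    also have "\<dots> < (\<bar>K\<bar> + 1) * d"
      using v by (intro mult_strict_left_mono) simp_all
    also have "\<dots> = e" by (simp add: d_def)
    finally show ?thesis .
  qed
  moreover have "d > 0" using e by (simp add: d_def)
  ultimately show "\<exists>d>0. \<forall>v\<in>mcarrier M. mnorm M (v - u) < d \<longrightarrow> mnorm N (L v - L u) < e"
    by blast
qed

end

lemma morphism_linear: "morphism A M N L \<Longrightarrow> mod_linear A M N L"
  by (simp add: morphism_def)

lemma morphism_mem: "morphism A M N L \<Longrightarrow> u \<in> mcarrier M \<Longrightarrow> L u \<in> mcarrier N"
  by (auto simp: morphism_def)

lemma morphism_bounded:
  assumes "morphism A M N L"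
  obtains K where "K > 0" "\<And>u. u \<in> mcarrier M \<Longrightarrow> mnorm N (L u) \<le> K * mnorm M u"
proof -
  note lin = morphism_linear[OF assms] and mem = morphism_mem[OF assms]
  have "mod_continuous M N L" using assms by (simp add: morphism_def)
  then obtain d where d: "d > 0"
    and small: "\<And>v. v \<in> mcarrier M \<Longrightarrow> mnorm M v < d \<Longrightarrow> mnorm N (L v) < 1"
    unfolding mod_continuous_def using linear_zero[OF lin]
    by (metis M.zero_mem diff_zero zero_less_one)
  have "mnorm N (L u) \<le> (2 / d) * mnorm M u" if u: "u \<in> mcarrier M" for u
  proof (cases "mnorm M u = 0")
    case True
    then show ?thesis using M.mnorm_eq_0[OF u] linear_zero[OF lin] by simp
  next
    case False
    then have pos: "0 < mnorm M u" using M.mnorm_nonneg[of u] by linarith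
    \<comment> \<open>The factor 2 places \<open>r *\<^sub>R u\<close> at norm \<open>d / 2\<close>,
      strictly inside the continuity radius at 0.\<close>
    define r where "r = d / (2 * mnorm M u)"
    have r: "r > 0" using d pos by (simp add: r_def)
    have "mnorm M (r *\<^sub>R u) < d"
      using u r d pos by (simp add: M.mnorm_scaleR) (simp add: r_def)
    then have "mnorm N (L (r *\<^sub>R u)) < 1" using u by (intro small) simp_all
    then have "r * mnorm N (L u) < 1"
      using u r by (simp add: linear_scaleR[OF lin] N.mnorm_scaleR mem)
    then show ?thesis using r pos d by (simp add: r_def field_simps)
  qed
  then show ?thesis using d by (intro that[of "2 / d"]) simp_all
qed

context
  fixes L L'
  assumes adj: "is_adjoint M N L' L" and map: "L \<in> mcarrier M \<rightarrow> mcarrier N"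
begin

lemma adjoint_mem: "v \<in> mcarrier N \<Longrightarrow> L' v \<in> mcarrier M"
  using adj by (auto simp: is_adjoint_def)

lemma map_mem: "u \<in> mcarrier M \<Longrightarrow> L u \<in> mcarrier N"
  using map by blast

lemma adjoint_prod: "u \<in> mcarrier M \<Longrightarrow> v \<in> mcarrier N \<Longrightarrow> mprod N (L u) v = mprod M u (L' v)"
  using adj by (auto simp: is_adjoint_def)

lemma adjoint_vform:
  "u \<in> mcarrier M \<Longrightarrow> v \<in> mcarrier N \<Longrightarrow> vform N h (L u) v = vform M h u (L' v)"
  by (simp add: vform_def adjoint_prod)

lemma adjoint_swap: "is_adjoint N M L L'"
  unfolding is_adjoint_def
proof (intro conjI ballI)
  fix v u assume uv: "v \<in> mcarrier N" "u \<in> mcarrier M"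
  show "mprod M (L' v) u = mprod N v (L u)"
  proof (rule is_adjoint_op_unique)
    show "is_adjoint_op (mprod M (L' v) u) (mprod M u (L' v))"
      using uv by (simp add: M.prod_adjoint adjoint_mem)
    show "is_adjoint_op (mprod N v (L u)) (mprod M u (L' v))"
      using N.prod_adjoint[of v "L u"] uv by (simp add: map_mem adjoint_prod)
  qed
qed (rule map)

text \<open>The predicate \<open>is_adjoint\<close> says nothing about linearity of
  \<open>L'\<close>. It is recovered by testing against all \<open>u\<close>, in the one combination
  that the later computations use.\<close>

lemma adjoint_diff_scaleR:
  assumes "v \<in> mcarrier N" "w \<in> mcarrier N"
  shows "L' (v - r *\<^sub>R w) = L' v - r *\<^sub>R L' w"
proof (rule M.eqI)
  fix h u assume u: "u \<in> mcarrier M"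
  have "vform M h u (L' (v - r *\<^sub>R w)) = vform N h (L u) v - r * vform N h (L u) w"
    using assms u
    by (simp add: adjoint_vform[symmetric] N.vform_diff_right N.vform_scaleR_right map_mem)
  also have "\<dots> = vform M h u (L' v - r *\<^sub>R L' w)"
    using assms u by (simp add: adjoint_vform M.vform_diff_right M.vform_scaleR_right adjoint_mem)
  finally show "vform M h u (L' (v - r *\<^sub>R w)) = vform M h u (L' v - r *\<^sub>R L' w)" .
qed (use assms in \<open>simp_all add: adjoint_mem\<close>)

context
  fixes K
  assumes K: "0 \<le> K" and bd: "\<And>u. u \<in> mcarrier M \<Longrightarrow> mnorm N (L u) \<le> K * mnorm M u"
begin

text \<open>In norms, \<open>|L' v|^2 = |(L (L' v), v)| \<le> K |L' v| |v|\<close>, and one factor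
  cancels; the estimate is made at each \<open>h\<close> and collected by
  \<open>mnorm_leI\<close>.\<close>

lemma adjoint_bounded:
  assumes v: "v \<in> mcarrier N"
  shows "mnorm M (L' v) \<le> K * mnorm N v"
proof -
  let ?m = "mnorm M (L' v)"
  have "?m \<le> sqrt (K * ?m * mnorm N v)"
  proof (rule M.mnorm_leI)
    fix h
    have "(vnorm M h (L' v))\<^sup>2 = vform N h (L (L' v)) v"
      using v by (simp add: M.vnorm_square adjoint_mem adjoint_vform)
    also have "\<dots> \<le> vnorm N h (L (L' v)) * vnorm N h v"
      using N.vform_bound[of "L (L' v)" v h] v by (simp add: adjoint_mem map_mem)
    also have "\<dots> \<le> (mnorm N (L (L' v)) * norm h) * (mnorm N v * norm h)"
      using v by (intro mult_mono N.vnorm_le_mnorm) (simp_all add: adjoint_mem map_mem)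
    also have "\<dots> \<le> ((K * ?m) * norm h) * (mnorm N v * norm h)"
      using v by (intro mult_right_mono bd adjoint_mem) simp_all
    finally have "sqrt ((vnorm M h (L' v))\<^sup>2) \<le> sqrt ((K * ?m * mnorm N v) * (norm h)\<^sup>2)"
      by (intro real_sqrt_le_mono) (simp add: power2_eq_square mult_ac)
    then show "vnorm M h (L' v) \<le> sqrt (K * ?m * mnorm N v) * norm h"
      using v by (simp add: real_sqrt_mult adjoint_mem)
  qed (use v K in \<open>simp_all add: adjoint_mem\<close>)
  then have "?m\<^sup>2 \<le> (sqrt (K * ?m * mnorm N v))\<^sup>2" by (rule power_mono) simp
  then have "?m * ?m \<le> (K * mnorm N v) * ?m"
    using K by (simp add: power2_eq_square mult_ac)
  then show ?thesis using K by (cases "?m = 0") (simp_all add: order.strict_iff_order)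
qed

text \<open>With \<open>S = L\<^sup>* L\<close>, the numbers \<open>vnorm M h (S\<^sup>n u)\<close> are log-convex in \<open>n\<close> and
  grow at most like \<open>K\<^sup>2\<^sup>n\<close>.\<close>

lemma vnorm_bounded:
  assumes u: "u \<in> mcarrier M"
  shows "vnorm N h (L u) \<le> K * vnorm M h u"
proof -
  define x where "x n = ((\<lambda>v. L' (L v)) ^^ n) u" for n
  have x_Suc: "x (Suc n) = L' (L (x n))" and x_0: "x 0 = u" for n
    by (simp_all add: x_def)
  have mem: "x n \<in> mcarrier M" for n
    by (induction n) (simp_all add: x_0 x_Suc u adjoint_mem map_mem)
  have grow: "mnorm M (x n) \<le> mnorm M u * (K\<^sup>2) ^ n" for n
  proof (induction n)
    case (Suc n)
    have "mnorm M (x (Suc n)) \<le> K * mnorm N (L (x n))"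
      unfolding x_Suc by (intro adjoint_bounded map_mem mem)
    also have "\<dots> \<le> K * (K * mnorm M (x n))"
      using K by (intro mult_left_mono bd mem)
    also have "\<dots> \<le> K * (K * (mnorm M u * (K\<^sup>2) ^ n))"
      using K Suc by (intro mult_left_mono)
    finally show ?case by (simp add: power2_eq_square mult_ac)
  qed (simp add: x_0)
  \<comment> \<open>Symmetry of \<open>L' L\<close> for each form; together with Cauchy-Schwarz it
    yields the log-convexity.\<close>
  have swap: "vform M h y (L' (L z)) = vform M h (L' (L y)) z"
    if "y \<in> mcarrier M" "z \<in> mcarrier M" for y z
    using that M.vform_sym[of "L' (L y)" z h] N.vform_sym[of "L y" "L z" h]
    by (simp add: adjoint_vform[symmetric] adjoint_mem map_mem)
  have "vnorm M h (x 1) \<le> K\<^sup>2 * vnorm M h (x 0)"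
  proof (rule log_convex_bound)
    show "0 \<le> vnorm M h (x n)" for n by (simp add: mem)
    show "(vnorm M h (x (Suc n)))\<^sup>2 \<le> vnorm M h (x n) * vnorm M h (x (Suc (Suc n)))" for n
    proof -
      have "(vnorm M h (x (Suc n)))\<^sup>2 = vform M h (x n) (x (Suc (Suc n)))"
        using swap[OF mem mem, of n "Suc n"] M.vnorm_square[OF mem, of h "Suc n"]
        by (simp add: x_Suc)
      then show ?thesis using M.vform_bound[of "x n" "x (Suc (Suc n))" h] mem by simp
    qed
    show "vnorm M h (x n) \<le> (mnorm M u * norm h) * (K\<^sup>2) ^ n" for n
      using M.vnorm_le_mnorm[OF mem, of h n] mult_right_mono[OF grow[of n], of "norm h"]
      by (simp add: mult_ac)
  qed simp
  then have le: "vnorm M h (L' (L u)) \<le> K\<^sup>2 * vnorm M h u" by (simp add: x_Suc x_0)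
  \<comment> \<open>Back from \<open>L' L\<close> to \<open>L\<close>: the square of the seminorm of
    \<open>L u\<close> is the pairing of \<open>u\<close> with \<open>L' (L u)\<close>.\<close>
  have "(vnorm N h (L u))\<^sup>2 = vform M h u (L' (L u))"
    using u by (simp add: N.vnorm_square map_mem adjoint_vform)
  also have "\<dots> \<le> vnorm M h u * vnorm M h (L' (L u))"
    using M.vform_bound[of u "L' (L u)" h] u by (simp add: map_mem adjoint_mem)
  also have "\<dots> \<le> vnorm M h u * (K\<^sup>2 * vnorm M h u)"
    using le u by (intro mult_left_mono) simp_all
  finally have "(vnorm N h (L u))\<^sup>2 \<le> (K * vnorm M h u)\<^sup>2"
    by (simp add: power2_eq_square mult_ac)
  then show ?thesis by (rule power2_le_imp_le) (use K u in simp)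
qed

end

end

lemma morphism_vnorm_bounded:
  assumes "morphism A M N L"
  obtains K where "K > 0" "\<And>h u. u \<in> mcarrier M \<Longrightarrow> vnorm N h (L u) \<le> K * vnorm M h u"
proof -
  obtain K where K: "K > 0" "\<And>u. u \<in> mcarrier M \<Longrightarrow> mnorm N (L u) \<le> K * mnorm M u"
    using morphism_bounded[OF assms] by blast
  moreover obtain L' where "is_adjoint M N L' L" "L \<in> mcarrier M \<rightarrow> mcarrier N"
    using assms by (auto simp: morphism_def)
  ultimately show ?thesis
    using vnorm_bounded[of L' L K] by (intro that[of K]) auto
qed

end

context pre_hilbert_pair
begin

lemma mnorm_le_of_vnorm_le:
  assumes "u \<in> mcarrier M" "v \<in> mcarrier N" "0 \<le> c" "\<And>h. vnorm N h v \<le> c * vnorm M h u"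
  shows "mnorm N v \<le> c * mnorm M u"
proof (rule N.mnorm_leI)
  fix h
  have "vnorm N h v \<le> c * vnorm M h u" by fact
  also have "\<dots> \<le> c * (mnorm M u * norm h)"
    using assms by (intro mult_left_mono M.vnorm_le_mnorm)
  finally show "vnorm N h v \<le> c * mnorm M u * norm h" by simp
qed (use assms in simp_all)

end

section \<open>Compact morphisms and small perturbations of the identity\<close>

context pre_hilbert_over
begin

lemma mod_linear_diff:
  assumes "mod_linear A M M P" "mod_linear A M M F"
    and "P \<in> mcarrier M \<rightarrow> mcarrier M" "F \<in> mcarrier M \<rightarrow> mcarrier M"
  shows "mod_linear A M M (\<lambda>u. P u - F u)"
  unfolding mod_linear_def
proof (intro conjI ballI allI)
  interpret pre_hilbert_pair A M M by unfold_locales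
  fix u assume u: "u \<in> mcarrier M"
  show "P (z *\<^sub>C u + v) - F (z *\<^sub>C u + v) = z *\<^sub>C (P u - F u) + (P v - F v)"
    if "v \<in> mcarrier M" for v z
    using that u assms(1,2)
    by (simp add: linear_add linear_scaleC complex_vector.scale_right_diff_distrib)
  show "P (mact M u a) - F (mact M u a) = mact M (P u - F u) a" if a: "a \<in> A" for a
  proof -
    have mem: "P u \<in> mcarrier M" "F u \<in> mcarrier M" using u assms(3,4) by auto
    have "mact M (P u) a = mact M (P u - F u) a + mact M (F u) a"
      using act_add[of "P u - F u" "F u" a] mem a by simp
    then show ?thesis
      using u a assms(1,2) by (simp add: linear_act)
  qed
qed

text \<open>A finite rank approximation \<open>F\<close> within 1/2 leaves the remainder
  \<open>E = P - F\<close>. Since \<open>E\<close> is adjointable, its norm bound 1/2 passes to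
  every seminorm.\<close>

lemma compact_morphism_decompose:
  assumes "compact_morphism A M M P"
  obtains n :: nat and us vs E where
    "\<And>i. i < n \<Longrightarrow> us i \<in> mcarrier M" "\<And>i. i < n \<Longrightarrow> vs i \<in> mcarrier M"
    "mod_linear A M M E" "E \<in> mcarrier M \<rightarrow> mcarrier M"
    "\<And>h u. u \<in> mcarrier M \<Longrightarrow> vnorm M h (E u) \<le> 1/2 * vnorm M h u"
    "\<And>u. u \<in> mcarrier M \<Longrightarrow> P u = (\<Sum>i<n. mact M (vs i) (mprod M (us i) u)) + E u"
proof -
  interpret pre_hilbert_pair A M M by unfold_locales
  have P: "morphism A M M P" using assms by (simp add: compact_morphism_def)
  have "\<forall>e>0. \<exists>F. finite_rank A M M F \<and> op_norm M M (\<lambda>u. P u - F u) < e"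
    using assms by (simp add: compact_morphism_def)
  from this[rule_format, of "1/2"] obtain F where "finite_rank A M M F" and small: "op_norm M M (\<lambda>u. P u - F u) < 1/2"
    by auto
  then obtain n :: nat and us vs where F: "morphism A M M F"
    and us: "us ` {..<n} \<subseteq> mcarrier M" and vs: "vs ` {..<n} \<subseteq> mcarrier M"
    and F_eq: "\<And>u. u \<in> mcarrier M \<Longrightarrow> F u = (\<Sum>i<n. elementary_op M M (us i) (vs i) u)"
    unfolding finite_rank_def by auto
  define E where "E u = P u - F u" for u
  have mem: "E u \<in> mcarrier M" if "u \<in> mcarrier M" for u
    using that by (simp add: E_def morphism_mem[OF P] morphism_mem[OF F])
  have lin: "mod_linear A M M E"
    unfolding E_def using P F by (intro mod_linear_diff) (auto simp: morphism_def)
  obtain P' where P': "is_adjoint M M P' P" using P by (auto simp: morphism_def)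
  obtain F' where F': "is_adjoint M M F' F" using F by (auto simp: morphism_def)
  have prod_diff: "mprod M x (y - z) = mprod M x y - mprod M x z"
    if "x \<in> mcarrier M" "y \<in> mcarrier M" "z \<in> mcarrier M" for x y z
    using prod_add_right[of x "y - z" z] that by simp
  have prod_diff_left: "mprod M (y - z) x = mprod M y x - mprod M z x"
    if "x \<in> mcarrier M" "y \<in> mcarrier M" "z \<in> mcarrier M" for x y z
    using prod_add_left[of "y - z" z x] that by simp
  have adj: "is_adjoint M M (\<lambda>v. P' v - F' v) E"
    using P' F' morphism_mem[OF P] morphism_mem[OF F]
    by (auto simp: is_adjoint_def E_def prod_diff prod_diff_left Pi_iff)
  obtain K1 where K1: "K1 > 0" "\<And>u. u \<in> mcarrier M \<Longrightarrow> mnorm M (P u) \<le> K1 * mnorm M u"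
    using morphism_bounded[OF P] by blast
  obtain K2 where K2: "K2 > 0" "\<And>u. u \<in> mcarrier M \<Longrightarrow> mnorm M (F u) \<le> K2 * mnorm M u"
    using morphism_bounded[OF F] by blast
  have unit: "mnorm M (E u) \<le> 1/2" if u: "u \<in> mcarrier M" "mnorm M u \<le> 1" for u
  proof -
    \<comment> \<open>The supremum in \<open>op_norm\<close> bounds the values of \<open>E\<close>
      only once they are known to be bounded, which the continuity of \<open>P\<close> and
      \<open>F\<close> provides.\<close>
    have "bdd_above ((\<lambda>u. mnorm M (E u)) ` {u \<in> mcarrier M. mnorm M u \<le> 1})"
    proof (rule bdd_aboveI2)
      fix v assume "v \<in> {u \<in> mcarrier M. mnorm M u \<le> 1}"
      then have v: "v \<in> mcarrier M" "mnorm M v \<le> 1" by auto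
      have "mnorm M (E v) \<le> mnorm M (P v) + mnorm M (F v)"
        unfolding E_def using v by (intro mnorm_triangle_diff morphism_mem[OF P] morphism_mem[OF F])
      also have "\<dots> \<le> K1 * mnorm M v + K2 * mnorm M v"
        using v by (intro add_mono K1 K2)
      also have "\<dots> \<le> K1 * 1 + K2 * 1"
        using v K1(1) K2(1) by (intro add_mono mult_left_mono) simp_all
      finally show "mnorm M (E v) \<le> K1 * 1 + K2 * 1" .
    qed
    then have "mnorm M (E u) \<le> op_norm M M E"
      unfolding op_norm_def using u by (intro cSUP_upper) auto
    also have "op_norm M M E < 1/2" using small by (simp add: E_def[abs_def])
    finally show ?thesis by simp
  qed
  have half: "mnorm M (E u) \<le> 1/2 * mnorm M u" if u: "u \<in> mcarrier M" for u
  proof (cases "mnorm M u = 0")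
    case True
    then have "u = 0" using u by (intro mnorm_eq_0)
    then show ?thesis by (simp add: linear_zero[OF lin])
  next
    case False
    then have pos: "0 < mnorm M u" using mnorm_nonneg[of u] by linarith
    have "mnorm M (E ((1 / mnorm M u) *\<^sub>R u)) \<le> 1/2"
      using u pos by (intro unit) (simp_all add: mnorm_scaleR)
    then show ?thesis
      using u pos by (simp add: linear_scaleR[OF lin] mnorm_scaleR mem field_simps)
  qed
  show ?thesis
  proof (rule that)
    show "vnorm M h (E u) \<le> 1/2 * vnorm M h u" if "u \<in> mcarrier M" for h u
      using vnorm_bounded[OF adj _ _ half that] mem by auto
    show "P u = (\<Sum>i<n. mact M (vs i) (mprod M (us i) u)) + E u" if "u \<in> mcarrier M" for u
      using F_eq[OF that] by (simp add: E_def elementary_op_def)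
  qed (use us vs lin mem in auto)
qed

text \<open>Neumann series: \<open>x\<close> is the sum of the terms \<open>z k\<close>, the k-th
  iterates of \<open>- E\<close> on \<open>v\<close>.\<close>

lemma solve_near_identity:
  assumes complete: "mcomplete M" and lin: "mod_linear A M M E"
    and map: "E \<in> mcarrier M \<rightarrow> mcarrier M"
    and half: "\<And>u. u \<in> mcarrier M \<Longrightarrow> mnorm M (E u) \<le> 1/2 * mnorm M u"
    and v: "v \<in> mcarrier M"
  shows "\<exists>x\<in>mcarrier M. x + E x = v"
proof -
  interpret pre_hilbert_pair A M M by unfold_locales
  have mem: "E u \<in> mcarrier M" if "u \<in> mcarrier M" for u using map that by auto
  define z where "z k = ((\<lambda>u. (- 1) *\<^sub>R E u) ^^ k) v" for k
  have z_0: "z 0 = v" and z_Suc: "z (Suc k) = (- 1) *\<^sub>R E (z k)" for k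
    by (simp_all add: z_def)
  have z_mem: "z k \<in> mcarrier M" for k
  proof (induction k)
    case (Suc k)
    then show ?case unfolding z_Suc by (intro scaleR_mem mem)
  qed (simp add: z_0 v)
  have z_bd: "mnorm M (z k) \<le> mnorm M v * (1/2) ^ k" for k
  proof (induction k)
    case (Suc k)
    have "mnorm M (z (Suc k)) = mnorm M (E (z k))"
      using mnorm_scaleR[OF mem[OF z_mem], of "- 1" k] by (simp add: z_Suc)
    then show ?case using half[OF z_mem, of k] Suc by simp
  qed (simp add: z_0)
  obtain x where x: "x \<in> mcarrier M" and lim: "(\<lambda>n. mnorm M ((\<Sum>k<n. z k) - x)) \<longlonglongrightarrow> 0"
    using summable_geometric[OF complete z_mem z_bd] by auto
  have s_mem: "(\<Sum>k<n. z k) \<in> mcarrier M" for n using z_mem by (intro sum_mem)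
  \<comment> \<open>One index apart, the partial sums satisfy the recursion whose limit is
    \<open>x = v - E x\<close>.\<close>
  have s_Suc: "(\<Sum>k<Suc n. z k) = v - E (\<Sum>k<n. z k)" for n
    unfolding sum.lessThan_Suc_shift z_0 z_Suc o_def
    using z_mem by (simp add: linear_sum[OF lin] sum_negf)
  have le: "mnorm M (x + E x - v) \<le>
      mnorm M ((\<Sum>k<Suc n. z k) - x) + 1/2 * mnorm M ((\<Sum>k<n. z k) - x)" for n
  proof -
    have "x + E x - v = (x - (\<Sum>k<Suc n. z k)) - E ((\<Sum>k<n. z k) - x)"
      unfolding s_Suc using x s_mem by (simp add: linear_diff[OF lin])
    then have "mnorm M (x + E x - v) \<le>
        mnorm M (x - (\<Sum>k<Suc n. z k)) + mnorm M (E ((\<Sum>k<n. z k) - x))"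
      using mnorm_triangle_diff[of "x - (\<Sum>k<Suc n. z k)" "E ((\<Sum>k<n. z k) - x)"] x s_mem
      by (simp only: diff_mem mem)
    moreover have "mnorm M (x - (\<Sum>k<Suc n. z k)) = mnorm M ((\<Sum>k<Suc n. z k) - x)"
      using x s_mem by (rule mnorm_diff_commute)
    moreover have "mnorm M (E ((\<Sum>k<n. z k) - x)) \<le> 1/2 * mnorm M ((\<Sum>k<n. z k) - x)"
      using x s_mem by (intro half diff_mem)
    ultimately show ?thesis by linarith
  qed
  have "(\<lambda>n. mnorm M ((\<Sum>k<Suc n. z k) - x) + 1/2 * mnorm M ((\<Sum>k<n. z k) - x))
      \<longlonglongrightarrow> 0 + 1/2 * 0"
    by (intro tendsto_intros lim LIMSEQ_Suc[OF lim])
  then have "mnorm M (x + E x - v) \<le> 0 + 1/2 * 0"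
    by (rule LIMSEQ_le_const) (use le in blast)
  then have "mnorm M (x + E x - v) = 0" using mnorm_nonneg[of "x + E x - v"] by linarith
  then have "x + E x - v = 0" using x v mem by (intro mnorm_eq_0) auto
  with x show ?thesis by auto
qed

end

context pre_hilbert_pair
begin

text \<open>Write \<open>G F = 1 + E + R\<close> with \<open>R\<close> of finite rank and
  \<open>E\<close> small. Replacing each \<open>v\<close> in \<open>R\<close> by a solution
  \<open>x\<close> of \<open>x + E x = v\<close> gives a finite rank \<open>R'\<close> with
  \<open>(1 + E) (z + R' z) = G (F z)\<close>. So \<open>F\<close> controls the identity up to
  finite rank, in each seminorm separately.\<close>

lemma left_fredholm_estimate:
  assumes complete: "mcomplete M" and F: "morphism A M N F" and G: "morphism A N M G"
    and P: "compact_morphism A M M P"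
    and GF: "\<And>u. u \<in> mcarrier M \<Longrightarrow> G (F u) = u + P u"
  obtains n :: nat and us vs c where
    "\<And>i. i < n \<Longrightarrow> us i \<in> mcarrier M" "\<And>i. i < n \<Longrightarrow> vs i \<in> mcarrier M" "c > 0"
    "\<And>h z. z \<in> mcarrier M \<Longrightarrow>
       vnorm M h (z + (\<Sum>i<n. mact M (vs i) (mprod M (us i) z))) \<le> c * vnorm N h (F z)"
proof -
  interpret MM: pre_hilbert_pair A M M by unfold_locales
  interpret NM: pre_hilbert_pair A N M by unfold_locales
  obtain n :: nat and us vs E where us: "\<And>i. i < n \<Longrightarrow> us i \<in> mcarrier M"
    and vs: "\<And>i. i < n \<Longrightarrow> vs i \<in> mcarrier M"
    and lin: "mod_linear A M M E" and map: "E \<in> mcarrier M \<rightarrow> mcarrier M"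
    and half: "\<And>h u. u \<in> mcarrier M \<Longrightarrow> vnorm M h (E u) \<le> 1/2 * vnorm M h u"
    and P_eq: "\<And>u. u \<in> mcarrier M \<Longrightarrow> P u = (\<Sum>i<n. mact M (vs i) (mprod M (us i) u)) + E u"
    by (rule M.compact_morphism_decompose[OF P]) blast
  have E_mem: "E u \<in> mcarrier M" if "u \<in> mcarrier M" for u using map that by auto
  have "mnorm M (E u) \<le> 1/2 * mnorm M u" if "u \<in> mcarrier M" for u
    using that half by (intro MM.mnorm_le_of_vnorm_le E_mem) auto
  then have "\<exists>x\<in>mcarrier M. x + E x = vs i" if "i < n" for i
    using M.solve_near_identity[OF complete lin map _ vs[OF that]] by blast
  then obtain xs where xs: "\<And>i. i < n \<Longrightarrow> xs i \<in> mcarrier M"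
    and xs_eq: "\<And>i. i < n \<Longrightarrow> xs i + E (xs i) = vs i"
    by metis
  obtain K where K: "K > 0" "\<And>h u. u \<in> mcarrier N \<Longrightarrow> vnorm M h (G u) \<le> K * vnorm N h u"
    using NM.morphism_vnorm_bounded[OF G] by blast
  have "vnorm M h (z + (\<Sum>i<n. mact M (xs i) (mprod M (us i) z))) \<le> (2 * K) * vnorm N h (F z)"
    if z: "z \<in> mcarrier M" for h z
  proof -
    let ?a = "\<lambda>i. mprod M (us i) z"
    let ?z = "z + (\<Sum>i<n. mact M (xs i) (?a i))"
    have act: "mact M (xs i) (?a i) \<in> mcarrier M" if "i < n" for i
      using that xs us z by simp
    have s_mem: "(\<Sum>i<n. mact M (xs i) (?a i)) \<in> mcarrier M"
      using act by (intro M.sum_mem) simp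
    have z_mem: "?z \<in> mcarrier M" using z s_mem by simp
    have "E (\<Sum>i<n. mact M (xs i) (?a i)) = (\<Sum>i<n. E (mact M (xs i) (?a i)))"
      by (rule MM.linear_sum[OF lin]) (use act in auto)
    also have "\<dots> = (\<Sum>i<n. mact M (E (xs i)) (?a i))"
      using xs us z by (intro sum.cong) (simp_all add: MM.linear_act[OF lin])
    finally have E_z: "E ?z = E z + (\<Sum>i<n. mact M (E (xs i)) (?a i))"
      using z s_mem by (simp add: MM.linear_add[OF lin])
    have "mact M (vs i) (?a i) = mact M (xs i) (?a i) + mact M (E (xs i)) (?a i)"
      if "i < n" for i
      using M.act_add[of "xs i" "E (xs i)" "?a i"] that xs us z E_mem by (simp add: xs_eq)
    then have "(\<Sum>i<n. mact M (vs i) (?a i)) =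
        (\<Sum>i<n. mact M (xs i) (?a i)) + (\<Sum>i<n. mact M (E (xs i)) (?a i))"
      by (simp add: sum.distrib)
    with E_z have "?z + E ?z = G (F z)"
      unfolding GF[OF z] P_eq[OF z] by (simp only: add_ac)
    \<comment> \<open>Half of the seminorm of \<open>?z\<close> reappears on the right and is
      absorbed, whence the constant \<open>2 * K\<close>.\<close>
    then have "?z = G (F z) - E ?z" by (simp only: eq_diff_eq)
    then have "vnorm M h ?z = vnorm M h (G (F z) - E ?z)" by (rule arg_cong)
    also have "\<dots> \<le> vnorm M h (G (F z)) + vnorm M h (E ?z)"
      by (intro M.vnorm_triangle_diff E_mem z_mem NM.morphism_mem[OF G] morphism_mem[OF F] z)
    also have "\<dots> \<le> K * vnorm N h (F z) + 1/2 * vnorm M h ?z"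
      using z_mem z by (intro add_mono K half morphism_mem[OF F])
    finally show ?thesis by simp
  qed
  then show ?thesis using us xs K by (intro that[of n us xs "2 * K"]) auto
qed

end

subsection \<open>The spectral gap of a left Fredholm morphism\<close>

lemma Re_cinner_tendsto:
  assumes "f \<longlonglongrightarrow> l"
  shows "(\<lambda>m. Re (cinner x (f m))) \<longlonglongrightarrow> Re (cinner x l)"
proof (rule LIM_zero_cancel, rule Lim_null_comparison)
  show "\<forall>\<^sub>F m in sequentially. norm (Re (cinner x (f m)) - Re (cinner x l)) \<le> norm x * norm (f m - l)"
    using Re_cinner_bound[of x "f _ - l"] by (simp add: cinner_diff_right)
  have "(\<lambda>m. norm x * norm (f m - l)) \<longlonglongrightarrow> norm x * 0"
    using assms by (intro tendsto_intros) (simp add: tendsto_norm_zero_iff LIM_zero_iff)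
  then show "(\<lambda>m. norm x * norm (f m - l)) \<longlonglongrightarrow> 0" by simp
qed

context pre_hilbert_over
begin

lemma vnorm_scaleR_vector:
  assumes "u \<in> mcarrier M"
  shows "vnorm M (r *\<^sub>R h) u = \<bar>r\<bar> * vnorm M h u"
proof -
  have "vform M (r *\<^sub>R h) u u = (r * r) * vform M h u u"
    by (simp add: vform_def blinfun.scaleR_right cinner_scaleR_left cinner_scaleR_right)
  then show ?thesis by (simp add: vnorm_def real_sqrt_mult)
qed

end

context pre_hilbert_pair
begin

text \<open>Morally, unit vectors \<open>z\<^sub>m \<otimes> k\<^sub>m\<close> of the Hilbert space
  \<open>M \<otimes>\<^sub>A H\<close>, orthogonal to the kernel of \<open>F\<close> and with \<open>F z\<^sub>m \<otimes> k\<^sub>m \<rightarrow> 0\<close>, would have a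
  convergent subsequence; its limit is both in the kernel and orthogonal to it. That Hilbert space
  is avoided by working with the vectors \<open>(u\<^sub>i, z\<^sub>m) k\<^sub>m\<close> of \<open>H\<close>, which converge
  along a subsequence because the products \<open>(u\<^sub>i, v\<^sub>j)\<close> are compact operators.\<close>

lemma spectral_gap:
  assumes complete: "mcomplete M" and F: "morphism A M N F" and F': "is_adjoint M N F' F"
    and G: "morphism A N M G" and P: "compact_morphism A M M P"
    and GF: "\<And>u. u \<in> mcarrier M \<Longrightarrow> G (F u) = u + P u"
  shows "\<exists>\<delta>>0. \<forall>w\<in>mcarrier N. \<forall>h. \<delta> * vnorm M h (F' w) \<le> vnorm N h (F (F' w))"
proof (rule ccontr)
  assume neg: "\<not> ?thesis"
  interpret NM: pre_hilbert_pair A N M by unfold_locales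
  have F_map: "F \<in> mcarrier M \<rightarrow> mcarrier N" using F by (simp add: morphism_def)
  note F_mem = morphism_mem[OF F] and F'_mem = adjoint_mem[OF F' F_map]
  obtain n :: nat and us vs c where us: "\<And>i. i < n \<Longrightarrow> us i \<in> mcarrier M"
    and vs: "\<And>i. i < n \<Longrightarrow> vs i \<in> mcarrier M" and c: "c > 0"
    and est: "\<And>h z. z \<in> mcarrier M \<Longrightarrow>
       vnorm M h (z + (\<Sum>i<n. mact M (vs i) (mprod M (us i) z))) \<le> c * vnorm N h (F z)"
    by (rule left_fredholm_estimate[OF complete F G P GF]) blast+
  define q where "q z = z + (\<Sum>i<n. mact M (vs i) (mprod M (us i) z))" for z
  have act_mem: "mact M (vs i) (mprod M (us i) z) \<in> mcarrier M"
    if "z \<in> mcarrier M" "i < n" for z i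
    using that us vs by simp
  have q_mem: "q z \<in> mcarrier M" if "z \<in> mcarrier M" for z
    unfolding q_def using that act_mem by (intro M.add_mem M.sum_mem) simp_all
  have q_est: "vnorm M h (q z) \<le> c * vnorm N h (F z)" if "z \<in> mcarrier M" for h z
    unfolding q_def using that by (rule est)
  \<comment> \<open>Everything is moved into the Hilbert space of the \<open>h\<close>: up to the
    vectors \<open>(x, z) h\<close>, only compact operators \<open>(x, vs i)\<close> applied to
    \<open>(us i, z) h\<close> occur.\<close>
  have prod_q: "blinfun_apply (mprod M x (q z)) h = blinfun_apply (mprod M x z) h +
      (\<Sum>i<n. blinfun_apply (mprod M x (vs i)) (blinfun_apply (mprod M (us i) z) h))"
    if x: "x \<in> mcarrier M" and z: "z \<in> mcarrier M" for x z h
  proof -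
    have "mprod M x (q z) = mprod M x z + (\<Sum>i<n. mprod M x (mact M (vs i) (mprod M (us i) z)))"
      unfolding q_def
      using M.prod_add_right[OF x z, of "\<Sum>i<n. mact M (vs i) (mprod M (us i) z)"]
        M.prod_sum_right[OF x, of "{..<n}" "\<lambda>i. mact M (vs i) (mprod M (us i) z)"]
        M.sum_mem[of "{..<n}" "\<lambda>i. mact M (vs i) (mprod M (us i) z)"] act_mem[OF z]
      by simp
    also have "(\<Sum>i<n. mprod M x (mact M (vs i) (mprod M (us i) z))) =
        (\<Sum>i<n. mprod M x (vs i) o\<^sub>L mprod M (us i) z)"
      using x z us vs by (intro sum.cong refl M.prod_act) simp_all
    finally show ?thesis by (simp add: blinfun.add_left blinfun.sum_left)
  qed

  have "\<exists>w h. w \<in> mcarrier N \<and> vnorm N h (F (F' w)) < 1 / Suc m * vnorm M h (F' w)" for m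
    using neg by (metis not_le of_nat_0_less_iff zero_less_Suc zero_less_divide_1_iff)
  then obtain w h0 where w: "\<And>m. w m \<in> mcarrier N"
    and less: "\<And>m. vnorm N (h0 m) (F (F' (w m))) < 1 / Suc m * vnorm M (h0 m) (F' (w m))"
    by metis
  define z where "z m = F' (w m)" for m
  have z: "z m \<in> mcarrier M" for m unfolding z_def by (intro F'_mem w)
  have pos: "0 < vnorm M (h0 m) (z m)" for m
  proof -
    have "0 < 1 / Suc m * vnorm M (h0 m) (z m)"
      using less[of m] N.vnorm_nonneg[OF F_mem[OF z], of "h0 m" m] unfolding z_def by linarith
    then show ?thesis by (simp add: zero_less_divide_iff)
  qed
  \<comment> \<open>The vector \<open>h0 m\<close> is normalised instead of \<open>z m\<close>,
    which stays equal to \<open>F' (w m)\<close>.\<close>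
  define k where "k m = (1 / vnorm M (h0 m) (z m)) *\<^sub>R h0 m" for m
  have unit: "vnorm M (k m) (z m) = 1" for m
    using pos[of m] by (simp add: k_def M.vnorm_scaleR_vector z)
  have Fz_le: "vnorm N (k m) (F (z m)) \<le> 1 / Suc m" for m
    using less[of m] pos[of m]
    by (simp add: k_def N.vnorm_scaleR_vector z F_mem z_def[symmetric] field_simps)
  have inv_lim: "(\<lambda>m. K * (1 / real (Suc m))) \<longlonglongrightarrow> 0" for K :: real
    using tendsto_mult[OF tendsto_const LIMSEQ_inverse_real_of_nat, of K]
    by (simp add: inverse_eq_divide)
  have q_le: "vnorm M (k m) (q (z m)) \<le> c * (1 / Suc m)" for m
  proof -
    have "vnorm M (k m) (q (z m)) \<le> c * vnorm N (k m) (F (z m))" by (rule q_est[OF z])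
    also have "\<dots> \<le> c * (1 / Suc m)" using c Fz_le by (intro mult_left_mono) simp_all
    finally show ?thesis .
  qed
  have prod_q_lim: "(\<lambda>m. blinfun_apply (mprod M x (q (z m))) (k m)) \<longlonglongrightarrow> 0"
    if x: "x \<in> mcarrier M" for x
  proof (rule Lim_null_comparison)
    have "norm (blinfun_apply (mprod M x (q (z m))) (k m)) \<le> (mnorm M x * c) * (1 / Suc m)" for m
    proof -
      have "norm (blinfun_apply (mprod M x (q (z m))) (k m)) \<le> mnorm M x * vnorm M (k m) (q (z m))"
        using x by (intro M.norm_prod_le q_mem z)
      also have "\<dots> \<le> mnorm M x * (c * (1 / Suc m))" by (intro mult_left_mono q_le) simp
      finally show ?thesis by (simp only: mult.assoc)
    qed
    then show "\<forall>\<^sub>F m in sequentially.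
        norm (blinfun_apply (mprod M x (q (z m))) (k m)) \<le> (mnorm M x * c) * (1 / Suc m)"
      by simp
  qed (rule inv_lim)

  define \<alpha> where "\<alpha> i m = blinfun_apply (mprod M (us i) (z m)) (k m)" for i m
  define \<beta> where "\<beta> i m = blinfun_apply (mprod M (vs i) (z m)) (k m)" for i m
  have \<alpha>_le: "norm (\<alpha> i m) \<le> mnorm M (us i)" if "i < n" for i m
    using M.norm_prod_le[OF us[OF that] z, of m "k m"] by (simp add: \<alpha>_def unit)
  have \<beta>_le: "norm (\<beta> i m) \<le> mnorm M (vs i)" if "i < n" for i m
    using M.norm_prod_le[OF vs[OF that] z, of m "k m"] by (simp add: \<beta>_def unit)
  have "\<exists>r. strict_mono r \<and> (\<forall>p\<in>{..<n} \<times> {..<n}.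
      convergent (\<lambda>m. blinfun_apply (mprod M (us (fst p)) (vs (snd p))) (\<alpha> (snd p) (r m))))"
    using us vs \<alpha>_le
    by (intro compact_op_family_subseq[where K = "\<lambda>p. mnorm M (us (snd p))"])
      (auto intro: M.prod_compact)
  then obtain r where r: "strict_mono r" and conv: "\<And>i j. i < n \<Longrightarrow> j < n \<Longrightarrow>
      convergent (\<lambda>m. blinfun_apply (mprod M (us i) (vs j)) (\<alpha> j (r m)))"
    by force
  \<comment> \<open>In \<open>prod_q\<close> with \<open>x = us i\<close> the left side tends to 0,
    and the terms of the sum are compact operators applied to bounded sequences, convergent along
    \<open>r\<close>. Hence the remaining term \<open>\<alpha> i\<close> converges along
    \<open>r\<close> as well.\<close>
  have "convergent (\<lambda>m. \<alpha> i (r m))" if i: "i < n" for i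
  proof -
    have "\<alpha> i (r m) = blinfun_apply (mprod M (us i) (q (z (r m)))) (k (r m)) -
        (\<Sum>j<n. blinfun_apply (mprod M (us i) (vs j)) (\<alpha> j (r m)))" for m
      using prod_q[OF us[OF i] z, of "r m" "k (r m)"] by (simp add: \<alpha>_def)
    moreover have "convergent (\<lambda>m. blinfun_apply (mprod M (us i) (q (z (r m)))) (k (r m)))"
      using LIMSEQ_subseq_LIMSEQ[OF prod_q_lim[OF us[OF i]] r]
      by (auto simp: o_def intro: convergentI)
    ultimately show ?thesis
      using conv[OF i] by (auto intro!: convergent_diff convergent_sum)
  qed
  then obtain l where l: "\<And>i. i < n \<Longrightarrow> (\<lambda>m. \<alpha> i (r m)) \<longlonglongrightarrow> l i"
    unfolding convergent_def by metis

  \<comment> \<open>The two indices are independent: first \<open>m\<close> is frozen while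
    \<open>m'\<close> tends to infinity, then both are taken equal.\<close>
  have cross: "Re (cinner (k m) (blinfun_apply (mprod M (z m) (q (z m'))) (k m'))) =
      Re (cinner (k m) (blinfun_apply (mprod M (z m) (z m')) (k m'))) +
      (\<Sum>i<n. Re (cinner (\<beta> i m) (\<alpha> i m')))" for m m'
  proof -
    have "cinner (k m) (blinfun_apply (mprod M (z m) (vs i)) (\<alpha> i m')) = cinner (\<beta> i m) (\<alpha> i m')"
      if "i < n" for i
      using M.prod_swap[OF z vs[OF that], of "k m" m "\<alpha> i m'"] by (simp add: \<beta>_def)
    then show ?thesis
      by (simp add: prod_q z cinner_add_right cinner_sum_right \<alpha>_def[symmetric])
  qed
  \<comment> \<open>Here it matters that \<open>z m\<close> is in the range of \<open>F'\<close>: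
    moving \<open>F'\<close> across the product turns \<open>(z m, z m') k m'\<close> into
    \<open>(w m, F (z m')) k m'\<close>, which tends to 0 for fixed \<open>m\<close>. This is the
    orthogonality of the limit to every \<open>z m\<close>.\<close>
  have orth: "(\<Sum>i<n. Re (cinner (\<beta> i m) (l i))) = 0" for m
  proof -
    have "(\<lambda>m'. blinfun_apply (mprod M (z m) (z m')) (k m')) \<longlonglongrightarrow> 0"
    proof (rule Lim_null_comparison)
      have "norm (blinfun_apply (mprod M (z m) (z m')) (k m')) \<le> mnorm N (w m) * (1 / Suc m')" for m'
      proof -
        have "mprod M (z m) (z m') = mprod N (w m) (F (z m'))"
          using NM.adjoint_prod[OF adjoint_swap[OF F' F_map] _ w z, of m m'] F'_mem
          by (simp add: z_def Pi_iff)
        then have "norm (blinfun_apply (mprod M (z m) (z m')) (k m')) \<le>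
            mnorm N (w m) * vnorm N (k m') (F (z m'))"
          by (simp add: N.norm_prod_le w F_mem z)
        also have "\<dots> \<le> mnorm N (w m) * (1 / Suc m')" by (intro mult_left_mono Fz_le) simp
        finally show ?thesis .
      qed
      then show "\<forall>\<^sub>F m' in sequentially.
          norm (blinfun_apply (mprod M (z m) (z m')) (k m')) \<le> mnorm N (w m) * (1 / Suc m')"
        by simp
    qed (rule inv_lim)
    from tendsto_diff[OF Re_cinner_tendsto[OF prod_q_lim[OF z], of "k m" m]
        Re_cinner_tendsto[OF this, of "k m"]]
    have "(\<lambda>m'. \<Sum>i<n. Re (cinner (\<beta> i m) (\<alpha> i m'))) \<longlonglongrightarrow> 0"
      by (simp add: cross)
    from LIMSEQ_subseq_LIMSEQ[OF this r]
    have "(\<lambda>m'. \<Sum>i<n. Re (cinner (\<beta> i m) (\<alpha> i (r m')))) \<longlonglongrightarrow> 0" by (simp add: o_def)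
    moreover have "(\<lambda>m'. \<Sum>i<n. Re (cinner (\<beta> i m) (\<alpha> i (r m')))) \<longlonglongrightarrow>
        (\<Sum>i<n. Re (cinner (\<beta> i m) (l i)))"
      by (intro tendsto_sum Re_cinner_tendsto l) simp
    ultimately show ?thesis by (rule LIMSEQ_unique[symmetric])
  qed
  \<comment> \<open>On the diagonal, subtracting \<open>orth\<close> replaces
    \<open>\<alpha>\<close> by \<open>\<alpha> - l\<close>, so the right side tends to 0 although
    the normalisation keeps it at least 1.\<close>
  have le: "1 \<le> c * (1 / Suc (r m)) + (\<Sum>i<n. mnorm M (vs i) * norm (\<alpha> i (r m) - l i))" for m
  proof -
    let ?m = "r m"
    have "vform M (k ?m) (z ?m) (q (z ?m)) \<le> c * (1 / Suc ?m)"
      using M.vform_bound[OF z q_mem[OF z], of "k ?m" ?m ?m] q_le[of ?m] by (simp add: unit)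
    moreover have "vform M (k ?m) (z ?m) (z ?m) = 1"
      using M.vnorm_square[OF z, of "k ?m" ?m] by (simp add: unit)
    ultimately have "1 \<le> c * (1 / Suc ?m) - (\<Sum>i<n. Re (cinner (\<beta> i ?m) (\<alpha> i ?m)))"
      using cross[of ?m ?m] by (simp add: vform_def)
    also have "(\<Sum>i<n. Re (cinner (\<beta> i ?m) (\<alpha> i ?m))) =
        (\<Sum>i<n. Re (cinner (\<beta> i ?m) (\<alpha> i ?m - l i)))"
      using orth[of ?m] by (simp add: cinner_diff_right sum_subtractf)
    finally have "1 \<le> c * (1 / Suc ?m) - (\<Sum>i<n. Re (cinner (\<beta> i ?m) (\<alpha> i ?m - l i)))" .
    moreover have "- (\<Sum>i<n. Re (cinner (\<beta> i ?m) (\<alpha> i ?m - l i))) \<le>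
        (\<Sum>i<n. mnorm M (vs i) * norm (\<alpha> i ?m - l i))"
      unfolding sum_negf[symmetric]
    proof (rule sum_mono)
      fix i assume i: "i \<in> {..<n}"
      have "- Re (cinner (\<beta> i ?m) (\<alpha> i ?m - l i)) \<le> norm (\<beta> i ?m) * norm (\<alpha> i ?m - l i)"
        using Re_cinner_bound[of "\<beta> i ?m" "\<alpha> i ?m - l i"] by simp
      also have "\<dots> \<le> mnorm M (vs i) * norm (\<alpha> i ?m - l i)"
        using i by (intro mult_right_mono \<beta>_le) simp_all
      finally show "- Re (cinner (\<beta> i ?m) (\<alpha> i ?m - l i)) \<le> mnorm M (vs i) * norm (\<alpha> i ?m - l i)" .
    qed
    ultimately show ?thesis by linarith
  qed
  have "(\<lambda>m. c * (1 / Suc (r m)) + (\<Sum>i<n. mnorm M (vs i) * norm (\<alpha> i (r m) - l i)))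
      \<longlonglongrightarrow> 0 + (\<Sum>i<n. mnorm M (vs i) * 0)"
  proof (intro tendsto_add tendsto_sum tendsto_mult tendsto_const)
    show "(\<lambda>m. c * (1 / Suc (r m))) \<longlonglongrightarrow> 0"
      using LIMSEQ_subseq_LIMSEQ[OF inv_lim r, of c] by (simp add: o_def)
    show "(\<lambda>m. norm (\<alpha> i (r m) - l i)) \<longlonglongrightarrow> 0" if "i \<in> {..<n}" for i
      using l[of i] that by (simp add: tendsto_norm_zero_iff LIM_zero_iff)
  qed
  then have "1 \<le> 0 + (\<Sum>i<n. mnorm M (vs i) * 0)"
    by (rule LIMSEQ_le_const) (use le in blast)
  then show False by simp
qed

text \<open>Summing \<open>t (1 - t F' F)^j F' w\<close> over \<open>j\<close> solves the normal
  equation by telescoping. The spectral gap makes the terms decay geometrically at a rate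
  independent of \<open>w\<close>, which yields the uniform constant.\<close>

lemma normal_equation_solvable:
  assumes complete: "mcomplete M" and F: "morphism A M N F" and F': "is_adjoint M N F' F"
    and G: "morphism A N M G" and P: "compact_morphism A M M P"
    and GF: "\<And>u. u \<in> mcarrier M \<Longrightarrow> G (F u) = u + P u"
  obtains C where "C > 0" "\<And>w. w \<in> mcarrier N \<Longrightarrow>
    \<exists>y\<in>mcarrier M. F' (F y) = F' w \<and> mnorm M y \<le> C * mnorm N w"
proof -
  interpret NM: pre_hilbert_pair A N M by unfold_locales
  have F_map: "F \<in> mcarrier M \<rightarrow> mcarrier N" using F by (simp add: morphism_def)
  note F_mem = morphism_mem[OF F] and F'_mem = adjoint_mem[OF F' F_map]
    and F_lin = morphism_linear[OF F]
  have F'_map: "F' \<in> mcarrier N \<rightarrow> mcarrier M" using F'_mem by blast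
  have F'_diff: "F' (v - v') = F' v - F' v'" if "v \<in> mcarrier N" "v' \<in> mcarrier N" for v v'
    using adjoint_diff_scaleR[OF F' F_map that, of 1] by simp
  obtain K where K: "K > 0" and F_bd: "\<And>u. u \<in> mcarrier M \<Longrightarrow> mnorm N (F u) \<le> K * mnorm M u"
    using morphism_bounded[OF F] by blast
  have F'_bd: "mnorm M (F' v) \<le> K * mnorm N v" if "v \<in> mcarrier N" for v
    by (rule adjoint_bounded[OF F' F_map less_imp_le[OF K] _ that]) (rule F_bd)
  have F'_vbd: "vnorm M h (F' v) \<le> K * vnorm N h v" if "v \<in> mcarrier N" for h v
    by (rule NM.vnorm_bounded[OF adjoint_swap[OF F' F_map] F'_map less_imp_le[OF K] _ that])
      (rule F'_bd)
  obtain \<delta>0 where \<delta>0: "\<delta>0 > 0"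
    and gap0: "\<And>w h. w \<in> mcarrier N \<Longrightarrow> \<delta>0 * vnorm M h (F' w) \<le> vnorm N h (F (F' w))"
    using spectral_gap[OF complete F F' G P GF] by blast
  \<comment> \<open>Lowering the gap to at most \<open>K\<close> gives
    \<open>t * \<delta>\<^sup>2 \<le> 1\<close>, so the root defining \<open>\<rho>\<close> is that
    of a nonnegative number.\<close>
  define \<delta> where "\<delta> = min \<delta>0 K"
  have \<delta>: "0 < \<delta>" "\<delta> \<le> K" using \<delta>0 K by (simp_all add: \<delta>_def)
  have gap: "\<delta> * vnorm M h (F' w) \<le> vnorm N h (F (F' w))" if "w \<in> mcarrier N" for w h
  proof -
    have "\<delta> * vnorm M h (F' w) \<le> \<delta>0 * vnorm M h (F' w)"
      using that by (intro mult_right_mono) (simp_all add: \<delta>_def F'_mem)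
    then show ?thesis using gap0[OF that, of h] by linarith
  qed
  define t where "t = 1 / K\<^sup>2"
  have t: "t > 0" using K by (simp add: t_def)
  define \<rho> where "\<rho> = sqrt (1 - t * \<delta>\<^sup>2)"
  have "t * \<delta>\<^sup>2 \<le> 1" using \<delta> K by (simp add: t_def divide_le_eq power_mono)
  moreover have "0 < t * \<delta>\<^sup>2" using t \<delta> by simp
  ultimately have \<rho>: "0 \<le> \<rho>" "\<rho> < 1" and \<rho>_sq: "\<rho>\<^sup>2 = 1 - t * \<delta>\<^sup>2"
    by (simp_all add: \<rho>_def)

  \<comment> \<open>For \<open>t = 1 / K\<^sup>2\<close> the term quadratic in \<open>t\<close>
    compensates at most half of the linear one. What remains is the square for \<open>z\<close>
    minus \<open>t\<close> times the square for \<open>F z\<close>, and the gap bounds the latter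
    from below.\<close>
  have contract: "vnorm M h (F' (w - t *\<^sub>R F (F' w))) \<le> \<rho> * vnorm M h (F' w)"
    if w: "w \<in> mcarrier N" for w h
  proof -
    define z where "z = F' w"
    have z: "z \<in> mcarrier M" using w by (simp add: z_def F'_mem)
    have Fz: "F z \<in> mcarrier N" "F' (F z) \<in> mcarrier M" using z by (simp_all add: F_mem F'_mem)
    have "F' (w - t *\<^sub>R F z) = z + (- t) *\<^sub>R F' (F z)"
      using adjoint_diff_scaleR[OF F' F_map w Fz(1), of t] by (simp add: z_def)
    then have "(vnorm M h (F' (w - t *\<^sub>R F z)))\<^sup>2 = (vnorm M h z)\<^sup>2 -
        2 * t * vform M h z (F' (F z)) + t\<^sup>2 * (vnorm M h (F' (F z)))\<^sup>2"
      using M.vnorm_add_square[OF z Fz(2), of h "- t"] by simp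
    also have "vform M h z (F' (F z)) = (vnorm N h (F z))\<^sup>2"
      using adjoint_vform[OF F' F_map z Fz(1), of h] Fz by (simp add: N.vnorm_square)
    also have "(vnorm M h (F' (F z)))\<^sup>2 \<le> (K * vnorm N h (F z))\<^sup>2"
      using F'_vbd[OF Fz(1), of h] Fz by (intro power_mono) simp_all
    then have "t\<^sup>2 * (vnorm M h (F' (F z)))\<^sup>2 \<le> t * (vnorm N h (F z))\<^sup>2"
      using K by (simp add: t_def power_mult_distrib power2_eq_square field_simps)
    finally have "(vnorm M h (F' (w - t *\<^sub>R F z)))\<^sup>2 \<le>
        (vnorm M h z)\<^sup>2 - t * (vnorm N h (F z))\<^sup>2" by simp
    moreover have "t * (\<delta> * vnorm M h z)\<^sup>2 \<le> t * (vnorm N h (F z))\<^sup>2"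
      using gap[OF w, of h] t \<delta> z by (intro mult_left_mono power_mono) (simp_all add: z_def)
    ultimately have "(vnorm M h (F' (w - t *\<^sub>R F z)))\<^sup>2 \<le> (\<rho> * vnorm M h z)\<^sup>2"
      by (simp add: power_mult_distrib \<rho>_sq algebra_simps)
    then show ?thesis
      unfolding z_def[symmetric] by (rule power2_le_imp_le) (use \<rho> z in simp)
  qed

  have "\<exists>y\<in>mcarrier M. F' (F y) = F' w \<and> mnorm M y \<le> (t * K / (1 - \<rho>)) * mnorm N w"
    if w: "w \<in> mcarrier N" for w
  proof -
    \<comment> \<open>The iteration runs in \<open>N\<close>, so that each
      \<open>z j = F' (x j)\<close> is visibly in the range of \<open>F'\<close>, where the gap is
      available.\<close>
    define x where "x j = ((\<lambda>v. v - t *\<^sub>R F (F' v)) ^^ j) w" for j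
    have x_0: "x 0 = w" and x_Suc: "x (Suc j) = x j - t *\<^sub>R F (F' (x j))" for j
      by (simp_all add: x_def)
    have x_mem: "x j \<in> mcarrier N" for j
      by (induction j) (simp_all add: x_0 x_Suc w F_mem F'_mem)
    define z where "z j = F' (x j)" for j
    have z_mem: "z j \<in> mcarrier M" for j by (simp add: z_def x_mem F'_mem)
    have z_vbd: "vnorm M h (z j) \<le> \<rho> ^ j * vnorm M h (z 0)" for h j
    proof (induction j)
      case (Suc j)
      have "vnorm M h (z (Suc j)) \<le> \<rho> * vnorm M h (z j)"
        unfolding z_def x_Suc by (rule contract[OF x_mem])
      also have "\<dots> \<le> \<rho> * (\<rho> ^ j * vnorm M h (z 0))" using \<rho> Suc by (intro mult_left_mono)
      finally show ?case by simp
    qed simp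
    interpret MM: pre_hilbert_pair A M M by unfold_locales
    have "mnorm M (z j) \<le> \<rho> ^ j * mnorm M (z 0)" for j
      using \<rho> by (intro MM.mnorm_le_of_vnorm_le z_mem z_vbd) simp_all
    moreover have "mnorm M (z 0) \<le> K * mnorm N w" unfolding z_def x_0 by (rule F'_bd[OF w])
    ultimately have z_bd: "mnorm M (z j) \<le> (K * mnorm N w) * \<rho> ^ j" for j
      using \<rho> mult_left_mono[of "mnorm M (z 0)" "K * mnorm N w" "\<rho> ^ j"]
      by (metis mult.commute order_trans zero_le_power)
    obtain y where y: "y \<in> mcarrier M" and lim: "(\<lambda>m. mnorm M ((\<Sum>j<m. z j) - y)) \<longlonglongrightarrow> 0"
      and y_bd: "mnorm M y \<le> (K * mnorm N w) / (1 - \<rho>)"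
      using M.summable_geometric[OF complete z_mem z_bd \<rho>] by blast
    define T where "T u = F' (F u)" for u
    have T_mem: "T u \<in> mcarrier M" if "u \<in> mcarrier M" for u
      using that by (simp add: T_def F_mem F'_mem)
    have T_diff_scaleR: "T (u - r *\<^sub>R v) = T u - r *\<^sub>R T v"
      if "u \<in> mcarrier M" "v \<in> mcarrier M" for u v r
      using that by (simp add: T_def linear_diff[OF F_lin] linear_scaleR[OF F_lin]
          adjoint_diff_scaleR[OF F' F_map] F_mem)
    have s_mem: "(\<Sum>j<m. z j) \<in> mcarrier M" for m using z_mem by (intro M.sum_mem)
    have T_0: "T 0 = 0" using T_diff_scaleR[of 0 0 1] by simp
    have T_scaleR: "T (r *\<^sub>R v) = r *\<^sub>R T v" if "v \<in> mcarrier M" for v r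
      using T_diff_scaleR[of 0 v "- r"] that by (simp add: T_0)
    \<comment> \<open>The telescoping identity. Since \<open>z m\<close> tends to 0, its limit reads
      \<open>T (t *\<^sub>R y) = z 0\<close>, which is \<open>F' w\<close>.\<close>
    have T_partial: "z m = z 0 - t *\<^sub>R T (\<Sum>j<m. z j)" for m
    proof (induction m)
      case (Suc m)
      have "z (Suc m) = z m - t *\<^sub>R T (z m)"
        unfolding z_def x_Suc T_def
        by (intro adjoint_diff_scaleR[OF F' F_map] x_mem F_mem F'_mem)
      moreover have "T ((\<Sum>j<m. z j) + z m) = T (\<Sum>j<m. z j) + T (z m)"
        using T_diff_scaleR[OF s_mem z_mem, of m "- 1" m] by simp
      ultimately show ?case using Suc by (simp add: scaleR_add_right)
    qed (simp add: T_0)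
    have le: "mnorm M (T (t *\<^sub>R y) - z 0) \<le>
        (t * K * K) * mnorm M ((\<Sum>j<m. z j) - y) + mnorm M (z m)" for m
    proof -
      have "T (t *\<^sub>R y) - z 0 = - (t *\<^sub>R T ((\<Sum>j<m. z j) - y) + z m)"
        using T_partial[of m] T_diff_scaleR[OF s_mem y, of m 1] y
        by (simp add: T_scaleR scaleR_diff_right)
      then have "mnorm M (T (t *\<^sub>R y) - z 0) = mnorm M (t *\<^sub>R T ((\<Sum>j<m. z j) - y) + z m)"
        using M.mnorm_minus[of "t *\<^sub>R T ((\<Sum>j<m. z j) - y) + z m"] T_mem s_mem y z_mem
        by (simp only: M.add_mem M.scaleR_mem M.diff_mem)
      also have "\<dots> \<le> mnorm M (t *\<^sub>R T ((\<Sum>j<m. z j) - y)) + mnorm M (z m)"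
        using T_mem s_mem y z_mem by (intro M.mnorm_triangle) simp_all
      also have "mnorm M (t *\<^sub>R T ((\<Sum>j<m. z j) - y)) = t * mnorm M (T ((\<Sum>j<m. z j) - y))"
        using T_mem s_mem y t by (simp add: M.mnorm_scaleR)
      also have "mnorm M (T ((\<Sum>j<m. z j) - y)) \<le> K * mnorm N (F ((\<Sum>j<m. z j) - y))"
        unfolding T_def using s_mem y by (intro F'_bd F_mem M.diff_mem)
      also have "mnorm N (F ((\<Sum>j<m. z j) - y)) \<le> K * mnorm M ((\<Sum>j<m. z j) - y)"
        using s_mem y by (intro F_bd M.diff_mem)
      finally show ?thesis using t K by (simp add: mult_left_mono mult.assoc)
    qed
    have "(\<lambda>m. (t * K * K) * mnorm M ((\<Sum>j<m. z j) - y) + mnorm M (z m))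
        \<longlonglongrightarrow> (t * K * K) * 0 + 0"
    proof (intro tendsto_add tendsto_mult tendsto_const lim)
      have "(\<lambda>m. (K * mnorm N w) * \<rho> ^ m) \<longlonglongrightarrow> (K * mnorm N w) * 0"
        using \<rho> by (intro tendsto_mult tendsto_const LIMSEQ_realpow_zero)
      then have g: "(\<lambda>m. (K * mnorm N w) * \<rho> ^ m) \<longlonglongrightarrow> 0" by simp
      have "norm (mnorm M (z m)) \<le> (K * mnorm N w) * \<rho> ^ m" for m
        using z_bd[of m] by simp
      then show "(\<lambda>m. mnorm M (z m)) \<longlonglongrightarrow> 0"
        by (intro Lim_null_comparison[OF _ g] always_eventually allI)
    qed
    then have "mnorm M (T (t *\<^sub>R y) - z 0) \<le> (t * K * K) * 0 + 0"
      by (rule LIMSEQ_le_const) (use le in blast)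
    then have "mnorm M (T (t *\<^sub>R y) - z 0) = 0"
      using M.mnorm_nonneg[of "T (t *\<^sub>R y) - z 0"] by linarith
    then have "T (t *\<^sub>R y) - z 0 = 0"
      using y z_mem T_mem by (intro M.mnorm_eq_0) simp_all
    then have "F' (F (t *\<^sub>R y)) = F' w" by (simp add: T_def z_def x_0)
    moreover have "mnorm M (t *\<^sub>R y) \<le> (t * K / (1 - \<rho>)) * mnorm N w"
      using mult_left_mono[OF y_bd, of t] y t by (simp add: M.mnorm_scaleR mult_ac)
    ultimately show ?thesis using y by (intro bexI[of _ "t *\<^sub>R y"]) simp_all
  qed
  moreover have "t * K / (1 - \<rho>) > 0" using t K \<rho> by simp
  ultimately show ?thesis using that by blast
qed

end

subsection \<open>Self-adjoint endomorphisms\<close>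

context pre_hilbert_over
begin

text \<open>If \<open>D x \<noteq> 0\<close>, then in \<open>vnorm M h (x + t *\<^sub>R D (D x))\<^sup>2\<close> the term
  linear in \<open>t\<close> is positive and cannot be compensated.\<close>

lemma self_adjoint_kernelI:
  assumes D: "self_adjoint_morphism A M D" and x: "x \<in> mcarrier M"
    and le: "\<And>t. t > 0 \<Longrightarrow>
      (mnorm M (x + t *\<^sub>R D (D x)))\<^sup>2 \<le> (mnorm M x)\<^sup>2 + t\<^sup>2 * (mnorm M (D (D x)))\<^sup>2"
  shows "D x = 0"
proof -
  interpret pre_hilbert_pair A M M by unfold_locales
  have mor: "morphism A M M D" and adj: "is_adjoint M M D D"
    using D by (simp_all add: self_adjoint_morphism_def)
  have map: "D \<in> mcarrier M \<rightarrow> mcarrier M" using mor by (simp add: morphism_def)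
  note mem = morphism_mem[OF mor]
  obtain K where K: "K > 0" and bd: "\<And>h u. u \<in> mcarrier M \<Longrightarrow> vnorm M h (D u) \<le> K * vnorm M h u"
    using morphism_vnorm_bounded[OF mor] by blast
  define z where "z = D (D x)"
  have z: "z \<in> mcarrier M" using x by (simp add: z_def mem)
  have form: "vform M h x z = (vnorm M h (D x))\<^sup>2" for h
    using adjoint_vform[OF adj map x, of "D x" h] x by (simp add: z_def mem vnorm_square)
  \<comment> \<open>The bound on \<open>D\<close> makes \<open>vform M h x z\<close> at least
    \<open>(vnorm M h z)\<^sup>2 / K\<^sup>2\<close>, so the linear term has a definite size. The
    terms with \<open>t\<^sup>2\<close> then cancel against the hypothesis, and an inequality linear
    in \<open>t\<close> is left.\<close>
  have "2 * t / K\<^sup>2 * (mnorm M z)\<^sup>2 \<le> (mnorm M x)\<^sup>2" if t: "t > 0" for t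
  proof -
    let ?c = "2 * t / K\<^sup>2 + t\<^sup>2"
    let ?b = "(mnorm M x)\<^sup>2 + t\<^sup>2 * (mnorm M z)\<^sup>2"
    have c: "?c > 0" using t K by (simp add: add_pos_pos)
    have b: "?b \<ge> 0" by simp
    have "mnorm M z \<le> sqrt (?b / ?c)"
    proof (rule mnorm_leI)
      fix h
      have "(vnorm M h z)\<^sup>2 \<le> (K * vnorm M h (D x))\<^sup>2"
        unfolding z_def using x by (intro power_mono bd mem) (simp_all add: mem)
      then have "(vnorm M h z)\<^sup>2 / K\<^sup>2 \<le> vform M h x z"
        using K by (simp add: form power_mult_distrib divide_le_eq mult.commute)
      then have "2 * t * ((vnorm M h z)\<^sup>2 / K\<^sup>2) \<le> 2 * t * vform M h x z"
        using t by (intro mult_left_mono) simp_all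
      moreover have "?c * (vnorm M h z)\<^sup>2 =
          2 * t * ((vnorm M h z)\<^sup>2 / K\<^sup>2) + t\<^sup>2 * (vnorm M h z)\<^sup>2"
        by (simp add: algebra_simps)
      ultimately have "?c * (vnorm M h z)\<^sup>2 \<le> (vnorm M h (x + t *\<^sub>R z))\<^sup>2"
        using vnorm_add_square[OF x z, of h t] zero_le_power2[of "vnorm M h x"] by linarith
      also have "\<dots> \<le> (mnorm M (x + t *\<^sub>R z) * norm h)\<^sup>2"
        using x z by (intro power_mono vnorm_le_mnorm) simp_all
      also have "\<dots> \<le> ?b * (norm h)\<^sup>2"
        using le[OF t] unfolding power_mult_distrib z_def by (intro mult_right_mono) simp_all
      finally have "(vnorm M h z)\<^sup>2 \<le> ?b / ?c * (norm h)\<^sup>2"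
        using c by (simp add: pos_le_divide_eq mult.commute)
      then have "sqrt ((vnorm M h z)\<^sup>2) \<le> sqrt (?b / ?c * (norm h)\<^sup>2)"
        by (rule real_sqrt_le_mono)
      then show "vnorm M h z \<le> sqrt (?b / ?c) * norm h"
        using z by (simp only: real_sqrt_mult real_sqrt_abs abs_of_nonneg vnorm_nonneg norm_ge_zero)
    qed (use z b c in simp_all)
    then have "(mnorm M z)\<^sup>2 \<le> (sqrt (?b / ?c))\<^sup>2" by (rule power_mono) simp
    also have "\<dots> = ?b / ?c" using b c by (intro real_sqrt_pow2 divide_nonneg_pos)
    finally have "(mnorm M z)\<^sup>2 * ?c \<le> ?b" using c by (simp only: pos_le_divide_eq)
    then show ?thesis by (simp add: algebra_simps)
  qed
  note small = this
  have "mnorm M z = 0"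
  proof (rule ccontr)
    assume nz: "mnorm M z \<noteq> 0"
    define b where "b = (mnorm M z)\<^sup>2"
    have b: "b > 0" using nz by (simp add: b_def)
    \<comment> \<open>This value turns the left side of \<open>small\<close> into
      \<open>(mnorm M x)\<^sup>2 + 1\<close>.\<close>
    define t where "t = K\<^sup>2 * ((mnorm M x)\<^sup>2 + 1) / (2 * b)"
    have "t > 0" unfolding t_def using K b
      by (intro divide_pos_pos mult_pos_pos add_nonneg_pos) simp_all
    from small[OF this] have "2 * t / K\<^sup>2 * b \<le> (mnorm M x)\<^sup>2" by (simp add: b_def)
    moreover have "2 * t / K\<^sup>2 * b = (mnorm M x)\<^sup>2 + 1" using K b by (simp add: t_def)
    ultimately show False by simp
  qed
  then have "z = 0" using z by (intro mnorm_eq_0)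
  \<comment> \<open>By \<open>form\<close>, all seminorms of \<open>D x\<close> vanish with
    \<open>z\<close>.\<close>
  then show ?thesis
    using form x by (intro eq_0I mem) (simp_all add: mem vnorm_square[symmetric])
qed

text \<open>Kernel and range of a self-adjoint \<open>D\<close> are orthogonal, so the decomposition
  is unique; linearity, self-adjointness and the bound for \<open>P\<close> follow from this. The
  hypothesis \<open>bound\<close> is what makes \<open>G\<close> continuous.\<close>

lemma parametrix_of_decomposition:
  assumes D: "self_adjoint_morphism A M D"
    and decomp: "\<And>u. u \<in> mcarrier M \<Longrightarrow> \<exists>k\<in>mcarrier M. \<exists>y\<in>mcarrier M. D k = 0 \<and> u = k + D y"
    and bound: "\<And>y. y \<in> mcarrier M \<Longrightarrow> mnorm M (D y) \<le> C * mnorm M (D (D y))" and C: "C > 0"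
  shows "self_adjoint_parametrix_possessing A M D"
proof -
  interpret pre_hilbert_pair A M M by unfold_locales
  have mor: "morphism A M M D" and adj: "is_adjoint M M D D"
    using D by (simp_all add: self_adjoint_morphism_def)
  have map: "D \<in> mcarrier M \<rightarrow> mcarrier M" using mor by (simp add: morphism_def)
  note mem = morphism_mem[OF mor] and lin = morphism_linear[OF mor]
  have kernel_range: "mprod M k (D y) = 0" "mprod M (D y) k = 0"
    if "k \<in> mcarrier M" "y \<in> mcarrier M" "D k = 0" for k y
    using adjoint_prod[OF adj map that(1,2)] adjoint_prod[OF adj map that(2,1)] that by simp_all
  \<comment> \<open>Such a \<open>D y\<close> lies in both range and kernel and is thus orthogonal
    to itself.\<close>
  have range_kernel_0: "D y = 0" if y: "y \<in> mcarrier M" and 0: "D (D y) = 0" for y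
    using kernel_range[OF mem[OF y] y 0] y by (intro mnorm_eq_0 mem) (simp_all add: mnorm_def)
  have unique: "k = k' \<and> D y = D y'"
    if "k \<in> mcarrier M" "y \<in> mcarrier M" "k' \<in> mcarrier M" "y' \<in> mcarrier M"
      "D k = 0" "D k' = 0" and eq: "k + D y = k' + D y'" for k y k' y'
  proof -
    have eq': "D (y - y') = k' - k"
      using eq that by (simp add: linear_diff[OF lin] algebra_simps)
    then have "D (D (y - y')) = 0" using that by (simp add: linear_diff[OF lin])
    from range_kernel_0[OF diff_mem[OF that(2,4)] this] have "D (y - y') = 0" .
    then show ?thesis using eq' that by (simp add: linear_diff[OF lin])
  qed

  define P where "P u = (SOME k. k \<in> mcarrier M \<and> D k = 0 \<and> (\<exists>y\<in>mcarrier M. u = k + D y))" for u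
  have P: "P u \<in> mcarrier M \<and> D (P u) = 0 \<and> (\<exists>y\<in>mcarrier M. u = P u + D y)"
    if "u \<in> mcarrier M" for u
  proof -
    have "\<exists>k. k \<in> mcarrier M \<and> D k = 0 \<and> (\<exists>y\<in>mcarrier M. u = k + D y)"
      using decomp[OF that] by blast
    from someI_ex[OF this] show ?thesis unfolding P_def .
  qed
  then have P_mem: "P u \<in> mcarrier M" and DP: "D (P u) = 0" if "u \<in> mcarrier M" for u
    using that by blast+
  have P_eq: "P u = k" if "u = k + D y" "k \<in> mcarrier M" "y \<in> mcarrier M" "D k = 0" for u k y
  proof -
    have "u \<in> mcarrier M" using that by (simp add: mem)
    from P[OF this] obtain y' where y': "P u \<in> mcarrier M" "y' \<in> mcarrier M" "D (P u) = 0"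
      "u = P u + D y'" by blast
    have "P u + D y' = k + D y" by (rule trans[OF y'(4)[symmetric] that(1)])
    with unique[OF y'(1,2) that(2,3) y'(3) that(4)] show ?thesis by blast
  qed
  \<comment> \<open>Decomposing \<open>y\<close> once more gives \<open>D y = D (D x)\<close>, so
    the preimage can be taken in the range of \<open>D\<close>. There it is unique, and
    \<open>bound\<close> applies to it.\<close>
  have ex_G: "\<exists>g. g \<in> D ` mcarrier M \<and> u = P u + D g" if u: "u \<in> mcarrier M" for u
  proof -
    obtain y where y: "y \<in> mcarrier M" "u = P u + D y" using P[OF u] by blast
    obtain k x where "k \<in> mcarrier M" "x \<in> mcarrier M" "D k = 0" "y = k + D x"
      using decomp[OF y(1)] by blast
    then have "D y = D (D x)" using mem by (simp add: linear_add[OF lin])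
    with y \<open>x \<in> mcarrier M\<close> show ?thesis by auto
  qed
  define G where "G u = (SOME g. g \<in> D ` mcarrier M \<and> u = P u + D g)" for u
  have G: "G u \<in> D ` mcarrier M \<and> u = P u + D (G u)" if "u \<in> mcarrier M" for u
    unfolding G_def by (rule someI_ex[OF ex_G[OF that]])
  then have G_range: "G u \<in> D ` mcarrier M" and split: "u = P u + D (G u)"
    if "u \<in> mcarrier M" for u
    using that by blast+
  have G_mem: "G u \<in> mcarrier M" if "u \<in> mcarrier M" for u
    using G_range[OF that] by (rule imageE) (simp add: mem)
  have G_eq: "G u = D y" if "u = k + D (D y)" "k \<in> mcarrier M" "y \<in> mcarrier M" "D k = 0" for u k y
  proof -
    have u: "u \<in> mcarrier M" using that by (simp add: mem)
    obtain y' where y': "y' \<in> mcarrier M" "G u = D y'" using G_range[OF u] by blast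
    have "D (D y') = D (D y)"
      using unique[OF P_mem[OF u] mem[OF y'(1)] that(2) mem[OF that(3)] DP[OF u] that(4)]
        split[OF u, unfolded y'(2)] that(1) by argo
    then have "D (D (y' - y)) = 0" using y' that by (simp add: linear_diff[OF lin] mem)
    from range_kernel_0[OF diff_mem[OF y'(1) that(3)] this] have "D (y' - y) = 0" .
    then show ?thesis using y' that by (simp add: linear_diff[OF lin])
  qed

  have P_lin: "mod_linear A M M P"
    unfolding mod_linear_def
  proof (intro conjI ballI allI)
    fix u assume u: "u \<in> mcarrier M"
    fix v z assume v: "v \<in> mcarrier M"
    show "P (z *\<^sub>C u + v) = z *\<^sub>C P u + P v"
    proof (rule P_eq)
      have "z *\<^sub>C u + v = z *\<^sub>C (P u + D (G u)) + (P v + D (G v))"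
        by (simp only: split[OF u, symmetric] split[OF v, symmetric])
      then show "z *\<^sub>C u + v = (z *\<^sub>C P u + P v) + D (z *\<^sub>C G u + G v)"
        using u v by (simp add: G_mem linear_add[OF lin] linear_scaleC[OF lin] scaleC_add_right)
    qed (use u v in \<open>simp_all add: P_mem G_mem DP linear_add[OF lin] linear_scaleC[OF lin]\<close>)
  next
    fix u a assume u: "u \<in> mcarrier M" and a: "a \<in> A"
    show "P (mact M u a) = mact M (P u) a"
    proof (rule P_eq)
      have "mact M u a = mact M (P u + D (G u)) a" by (simp only: split[OF u, symmetric])
      then show "mact M u a = mact M (P u) a + D (mact M (G u) a)"
        using u a by (simp add: act_add P_mem G_mem mem linear_act[OF lin])
    qed (use u a in \<open>simp_all add: P_mem G_mem DP linear_act[OF lin]\<close>)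
  qed
  have G_lin: "mod_linear A M M G"
    unfolding mod_linear_def
  proof (intro conjI ballI allI)
    fix u assume u: "u \<in> mcarrier M"
    fix v z assume v: "v \<in> mcarrier M"
    obtain x y where xy: "x \<in> mcarrier M" "y \<in> mcarrier M" "G u = D x" "G v = D y"
      using G_range[OF u] G_range[OF v] by blast
    have "G (z *\<^sub>C u + v) = D (z *\<^sub>C x + y)"
    proof (rule G_eq)
      have "z *\<^sub>C u + v = z *\<^sub>C (P u + D (D x)) + (P v + D (D y))"
        by (simp only: split[OF u, unfolded xy(3), symmetric] split[OF v, unfolded xy(4), symmetric])
      then show "z *\<^sub>C u + v = (z *\<^sub>C P u + P v) + D (D (z *\<^sub>C x + y))"
        using u v xy by (simp add: mem linear_add[OF lin] linear_scaleC[OF lin] scaleC_add_right)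
    qed (use u v xy in \<open>simp_all add: P_mem DP linear_add[OF lin] linear_scaleC[OF lin]\<close>)
    then show "G (z *\<^sub>C u + v) = z *\<^sub>C G u + G v"
      using xy by (simp add: linear_add[OF lin] linear_scaleC[OF lin])
  next
    fix u a assume u: "u \<in> mcarrier M" and a: "a \<in> A"
    obtain x where x: "x \<in> mcarrier M" "G u = D x" using G_range[OF u] by blast
    have "G (mact M u a) = D (mact M x a)"
    proof (rule G_eq)
      have "mact M u a = mact M (P u + D (D x)) a"
        by (simp only: split[OF u, unfolded x(2), symmetric])
      then show "mact M u a = mact M (P u) a + D (D (mact M x a))"
        using u a x by (simp add: act_add P_mem mem linear_act[OF lin])
    qed (use u a x in \<open>simp_all add: P_mem DP linear_act[OF lin]\<close>)
    then show "G (mact M u a) = mact M (G u) a" using x a by (simp add: linear_act[OF lin])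
  qed

  \<comment> \<open>Consequently \<open>P\<close> and \<open>D G\<close>, the projections onto
    kernel and range, have norm at most 1.\<close>
  have pythagoras: "vform M h u u = vform M h (P u) (P u) + vform M h (D (G u)) (D (G u))"
    if u: "u \<in> mcarrier M" for u h
  proof -
    have "mprod M u u = mprod M (P u + D (G u)) (P u + D (G u))"
      by (simp only: split[OF u, symmetric])
    also have "\<dots> = mprod M (P u) (P u) + mprod M (D (G u)) (D (G u))"
      using u kernel_range[OF P_mem[OF u] G_mem[OF u] DP[OF u]]
      by (simp add: prod_add_left prod_add_right P_mem G_mem mem)
    finally show ?thesis by (simp add: vform_def blinfun.add_left cinner_add_right)
  qed
  have P_bd: "mnorm M (P u) \<le> 1 * mnorm M u" and DG_bd: "mnorm M (D (G u)) \<le> 1 * mnorm M u"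
    if u: "u \<in> mcarrier M" for u
  proof -
    have nn: "0 \<le> vform M h (P u) (P u)" "0 \<le> vform M h (D (G u)) (D (G u))" for h
      using u by (intro vform_nonneg mem P_mem G_mem; assumption)+
    show "mnorm M (P u) \<le> 1 * mnorm M u"
      using u pythagoras[OF u] nn by (intro mnorm_le_of_vnorm_le P_mem) (simp_all add: vnorm_def)
    show "mnorm M (D (G u)) \<le> 1 * mnorm M u"
      using u pythagoras[OF u] nn
      by (intro mnorm_le_of_vnorm_le mem G_mem) (simp_all add: vnorm_def)
  qed
  have G_bd: "mnorm M (G u) \<le> C * mnorm M u" if u: "u \<in> mcarrier M" for u
  proof -
    obtain y where y: "y \<in> mcarrier M" "G u = D y" using G_range[OF u] by blast
    have "mnorm M (G u) \<le> C * mnorm M (D (G u))" using bound[OF y(1)] y by simp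
    also have "\<dots> \<le> C * mnorm M u" using DG_bd[OF u] C by (intro mult_left_mono) simp_all
    finally show ?thesis .
  qed

  have P_adj: "is_adjoint M M P P"
    unfolding is_adjoint_def
  proof (intro conjI ballI)
    fix u v assume u: "u \<in> mcarrier M" and v: "v \<in> mcarrier M"
    have "mprod M (P u) v = mprod M (P u) (P v + D (G v))"
      by (simp only: split[OF v, symmetric])
    also have "\<dots> = mprod M (P u) (P v)"
      using kernel_range(1)[OF P_mem[OF u] G_mem[OF v] DP[OF u]] u v
      by (simp add: prod_add_right P_mem G_mem mem)
    also have "\<dots> = mprod M (P u + D (G u)) (P v)"
      using kernel_range(2)[OF P_mem[OF v] G_mem[OF u] DP[OF v]] u v
      by (simp add: prod_add_left P_mem G_mem mem)
    finally show "mprod M (P u) v = mprod M u (P v)"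
      by (simp only: split[OF u, symmetric])
  qed (use P_mem in blast)
  \<comment> \<open>With the kernel parts dropping out,
    \<open>(G u, v) = (G u, D (G v)) = (D (G u), G v) = (u, G v)\<close>.\<close>
  have G_adj: "is_adjoint M M G G"
    unfolding is_adjoint_def
  proof (intro conjI ballI)
    fix u v assume u: "u \<in> mcarrier M" and v: "v \<in> mcarrier M"
    obtain x y where xy: "x \<in> mcarrier M" "y \<in> mcarrier M" "G u = D x" "G v = D y"
      using G_range[OF u] G_range[OF v] by blast
    have "mprod M (G u) v = mprod M (G u) (P v + D (G v))"
      by (simp only: split[OF v, symmetric])
    also have "\<dots> = mprod M (G u) (D (G v))"
      using kernel_range(2)[OF P_mem[OF v] xy(1) DP[OF v]] xy u v
      by (simp add: prod_add_right P_mem G_mem mem)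
    also have "\<dots> = mprod M (D (G u)) (G v)"
      using adjoint_prod[OF adj map G_mem[OF u] G_mem[OF v]] by simp
    also have "\<dots> = mprod M (P u + D (G u)) (G v)"
      using kernel_range(1)[OF P_mem[OF u] xy(2) DP[OF u]] xy u v
      by (simp add: prod_add_left P_mem G_mem mem)
    finally show "mprod M (G u) v = mprod M u (G v)"
      by (simp only: split[OF u, symmetric])
  qed (use G_mem in blast)

  have P_mor: "self_adjoint_morphism A M P"
    unfolding self_adjoint_morphism_def morphism_def
    using P_adj P_mem P_lin bounded_imp_continuous[OF P_lin P_bd] by blast
  have G_mor: "morphism A M M G"
    unfolding morphism_def using G_adj G_mem G_lin bounded_imp_continuous[OF G_lin G_bd] by blast
  have GD: "u = G (D u) + P u" if u: "u \<in> mcarrier M" for u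
  proof -
    obtain y where y: "y \<in> mcarrier M" "u = P u + D y" using P[OF u] by blast
    \<comment> \<open>The kernel component of \<open>D u\<close> is 0, so \<open>G_eq\<close> reads
      off \<open>G (D u) = D y\<close>.\<close>
    have "D u = 0 + D (D y)"
      using arg_cong[OF y(2), of D] y(1) u by (simp add: linear_add[OF lin] P_mem DP mem)
    from G_eq[OF this zero_mem y(1) linear_zero[OF lin]] have "G (D u) = D y" .
    then show ?thesis using y(2) by (simp only: add.commute)
  qed
  have DG: "u = D (G u) + P u" if "u \<in> mcarrier M" for u
    using split[OF that] by (simp only: add.commute)
  show ?thesis
    unfolding self_adjoint_parametrix_possessing_def using D P_mor G_mor GD DG DP by blast
qed

end

section \<open>The parametrix of \<open>D\<close> from its Fredholm extension\<close>

theorem theorem6: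
  fixes A :: "('h::chilbert_space \<Rightarrow>\<^sub>L 'h) set"
    and U V W :: "('h, 'm::complex_vector) hmodule"
    and D Dt Dt_adj :: "'m \<Rightarrow> 'm"
  assumes "cstar_compact A"
    and "hilbert_module A V"
    and "hilbert_module A W"
    and "pre_hilbert_module A U"
    and "mcarrier U \<subseteq> mcarrier V"
    and "mcarrier U \<subseteq> mcarrier W"
    and "\<forall>u\<in>mcarrier U. mnorm W u = mnorm U u"
    and "\<exists>C>0. \<forall>u\<in>mcarrier U. mnorm U u \<le> C * mnorm V u"
    and "self_adjoint_morphism A U D"
    and "morphism A V W Dt"
    and "is_adjoint V W Dt_adj Dt"
    and "\<forall>u\<in>mcarrier U. Dt u = D u"
    and "fredholm A V W Dt"
    and "{v \<in> mcarrier V. Dt v \<in> mcarrier U} \<subseteq> mcarrier U"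
    and "{w \<in> mcarrier W. Dt_adj w \<in> mcarrier U} \<subseteq> mcarrier U"
    and "mod_kernel V Dt \<subseteq> mcarrier U"
    and "mod_kernel W Dt_adj \<subseteq> mcarrier U"
  shows "self_adjoint_parametrix_possessing A U D"
proof -
  note UV = assms(5) and UW = assms(6) and norms = assms(7) and D = assms(9)
    and F = assms(10) and F' = assms(11) and ext = assms(12)
  interpret U: pre_hilbert_over A U using assms(1,4) by unfold_locales
  interpret V: pre_hilbert_over A V using assms(1,2) by unfold_locales (simp_all add: hilbert_module_def)
  interpret W: pre_hilbert_over A W using assms(1,3) by unfold_locales (simp_all add: hilbert_module_def)
  interpret UU: pre_hilbert_pair A U U by unfold_locales
  interpret VW: pre_hilbert_pair A V W by unfold_locales
  have D_mor: "morphism A U U D" using D by (simp add: self_adjoint_morphism_def)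
  have D_adj: "is_adjoint U U D D" using D by (simp add: self_adjoint_morphism_def)
  note D_mem = UU.morphism_mem[OF D_mor] and D_lin = UU.morphism_linear[OF D_mor]
  have D_map: "D \<in> mcarrier U \<rightarrow> mcarrier U" using D_mem by blast
  have F_map: "Dt \<in> mcarrier V \<rightarrow> mcarrier W" using F by (simp add: morphism_def)
  note F_mem = VW.morphism_mem[OF F] and F_lin = VW.morphism_linear[OF F]
    and F'_mem = VW.adjoint_mem[OF F' F_map]
  obtain C1 where C1: "C1 > 0" and dom: "\<And>u. u \<in> mcarrier U \<Longrightarrow> mnorm U u \<le> C1 * mnorm V u"
    using assms(8) by blast
  obtain G PV where "morphism A W V G" "compact_morphism A V V PV"
    "\<And>u. u \<in> mcarrier V \<Longrightarrow> G (Dt u) = u + PV u"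
    using assms(13) unfolding fredholm_def by blast
  moreover have "mcomplete V" using assms(2) by (simp add: hilbert_module_def)
  ultimately obtain C2 where C2: "C2 > 0" and solve: "\<And>w. w \<in> mcarrier W \<Longrightarrow>
      \<exists>y\<in>mcarrier V. Dt_adj (Dt y) = Dt_adj w \<and> mnorm V y \<le> C2 * mnorm W w"
    using VW.normal_equation_solvable[OF _ F F'] by metis
  have F'_0: "Dt_adj 0 = 0"
    using VW.adjoint_diff_scaleR[OF F' F_map, of 0 0 1] by simp
  have kernel: "x \<in> mcarrier U \<and> D x = 0" if x: "x \<in> mcarrier W" "Dt_adj x = 0" for x
  proof
    show xU: "x \<in> mcarrier U" using assms(17) x by (auto simp: mod_kernel_def)
    show "D x = 0"
    proof (rule U.self_adjoint_kernelI[OF D xU])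
      fix t :: real
      define z where "z = D (D x)"
      have zU: "z \<in> mcarrier U" using xU by (simp add: z_def D_mem)
      have zW: "z \<in> mcarrier W" and DxV: "D x \<in> mcarrier V" using zU xU UV UW D_mem by auto
      have z_eq: "z = Dt (D x)" using ext xU by (simp add: z_def D_mem)
      \<comment> \<open>\<open>z\<close> is in the range of \<open>Dt\<close> and \<open>x\<close>
        in the kernel of \<open>Dt_adj\<close>. This orthogonality holds in \<open>W\<close>; it
        reaches \<open>U\<close> only through the norms.\<close>
      have orth: "vform W h x z = 0" for h
        using VW.adjoint_vform[OF F' F_map DxV x(1), of h] x zW DxV
        by (simp add: z_eq W.vform_sym[of x])
      have "mnorm W (x + t *\<^sub>R z) \<le> sqrt ((mnorm W x)\<^sup>2 + t\<^sup>2 * (mnorm W z)\<^sup>2)"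
      proof (rule W.mnorm_leI)
        fix h
        have "(vnorm W h (x + t *\<^sub>R z))\<^sup>2 = (vnorm W h x)\<^sup>2 + t\<^sup>2 * (vnorm W h z)\<^sup>2"
          using W.vnorm_add_square[OF x(1) zW, of h t] by (simp add: orth)
        also have "\<dots> \<le> (mnorm W x * norm h)\<^sup>2 + t\<^sup>2 * (mnorm W z * norm h)\<^sup>2"
          using x zW by (intro add_mono mult_left_mono power_mono W.vnorm_le_mnorm) simp_all
        also have "\<dots> = ((mnorm W x)\<^sup>2 + t\<^sup>2 * (mnorm W z)\<^sup>2) * (norm h)\<^sup>2"
          by (simp add: power_mult_distrib algebra_simps)
        finally have "sqrt ((vnorm W h (x + t *\<^sub>R z))\<^sup>2) \<le>
            sqrt (((mnorm W x)\<^sup>2 + t\<^sup>2 * (mnorm W z)\<^sup>2) * (norm h)\<^sup>2)"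
          by (rule real_sqrt_le_mono)
        then show "vnorm W h (x + t *\<^sub>R z) \<le>
            sqrt ((mnorm W x)\<^sup>2 + t\<^sup>2 * (mnorm W z)\<^sup>2) * norm h"
          using x zW by (simp add: real_sqrt_mult)
      qed (use x zW in simp_all)
      then have "(mnorm W (x + t *\<^sub>R z))\<^sup>2 \<le> (sqrt ((mnorm W x)\<^sup>2 + t\<^sup>2 * (mnorm W z)\<^sup>2))\<^sup>2"
        by (rule power_mono) simp
      then show "(mnorm U (x + t *\<^sub>R D (D x)))\<^sup>2 \<le>
          (mnorm U x)\<^sup>2 + t\<^sup>2 * (mnorm U (D (D x)))\<^sup>2"
        using norms xU zU by (simp add: z_def)
    qed
  qed
  show ?thesis
  proof (rule U.parametrix_of_decomposition[OF D])
    fix u assume u: "u \<in> mcarrier U"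
    then have uW: "u \<in> mcarrier W" using UW by blast
    \<comment> \<open>The residual \<open>u - Dt y\<close> is in the kernel of
      \<open>Dt_adj\<close>. Regularity puts first the residual, then \<open>Dt y\<close> and
      finally \<open>y\<close> into \<open>U\<close>.\<close>
    obtain y where y: "y \<in> mcarrier V" "Dt_adj (Dt y) = Dt_adj u" using solve[OF uW] by blast
    have "Dt_adj (u - Dt y) = 0"
      using VW.adjoint_diff_scaleR[OF F' F_map uW F_mem[OF y(1)], of 1] y by simp
    then have k: "u - Dt y \<in> mcarrier U" "D (u - Dt y) = 0"
      using kernel[of "u - Dt y"] uW y F_mem by auto
    have "Dt y \<in> mcarrier U" using U.diff_mem[OF u k(1)] by simp
    then have "y \<in> mcarrier U" using y assms(14) by blast
    moreover from this have "u = (u - Dt y) + D y" using ext by simp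
    ultimately show "\<exists>k\<in>mcarrier U. \<exists>y\<in>mcarrier U. D k = 0 \<and> u = k + D y"
      using k by blast
  next
    fix x assume x: "x \<in> mcarrier U"
    \<comment> \<open>To bound \<open>g\<close> by \<open>D g\<close>, the normal equation with
      right side \<open>Dt_adj (D g)\<close> is solved anew: its solution \<open>y\<close> has
      controlled norm and differs from \<open>g\<close> by an element of the kernel of
      \<open>Dt\<close>.\<close>
    define g where "g = D x"
    have g: "g \<in> mcarrier U" "g \<in> mcarrier V" using x UV by (auto simp: g_def D_mem)
    have Dg: "D g \<in> mcarrier U" "D g \<in> mcarrier W" "Dt g = D g"
      using g UW ext by (auto simp: D_mem)
    obtain y where y: "y \<in> mcarrier V" "Dt_adj (Dt y) = Dt_adj (D g)"
      and y_le: "mnorm V y \<le> C2 * mnorm W (D g)"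
      using solve[OF Dg(2)] by blast
    define k where "k = g - y"
    have kV: "k \<in> mcarrier V" using g y by (simp add: k_def)
    have F'Fk: "Dt_adj (Dt k) = 0"
      using VW.adjoint_diff_scaleR[OF F' F_map F_mem[OF g(2)] F_mem[OF y(1)], of 1] y g Dg
      by (simp add: k_def VW.linear_diff[OF F_lin])
    have "Dt k = 0"
    proof (rule W.eq_0I)
      fix h
      show "vform W h (Dt k) (Dt k) = 0"
        using VW.adjoint_vform[OF F' F_map kV F_mem[OF kV], of h] kV by (simp add: F'Fk)
    qed (rule F_mem[OF kV])
    then have k: "k \<in> mcarrier U" "D k = 0"
      using kV assms(16) ext by (auto simp: mod_kernel_def subset_iff)
    have yU: "y \<in> mcarrier U" using U.diff_mem[OF g(1) k(1)] by (simp add: k_def)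
    \<comment> \<open>In \<open>U\<close> the range element \<open>g = D x\<close> is orthogonal to
      the kernel element \<open>k\<close>, so \<open>y = g - k\<close> is at least as long as
      \<open>g\<close> in every seminorm.\<close>
    have "mnorm U g \<le> 1 * mnorm U y"
    proof (rule UU.mnorm_le_of_vnorm_le[OF yU g(1)])
      fix h
      have "vform U h g k = 0"
        using UU.adjoint_vform[OF D_adj D_map x k(1), of h] k x by (simp add: g_def)
      moreover have "y = g + (- 1) *\<^sub>R k" by (simp add: k_def)
      ultimately have "(vnorm U h y)\<^sup>2 = (vnorm U h g)\<^sup>2 + (vnorm U h k)\<^sup>2"
        using U.vnorm_add_square[OF g(1) k(1), of h "- 1"] by simp
      then show "vnorm U h g \<le> 1 * vnorm U h y"
        using yU by (intro power2_le_imp_le[of "vnorm U h g"]) simp_all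
    qed simp
    \<comment> \<open>The norms are chained: that of \<open>V\<close> dominates that of
      \<open>U\<close>, \<open>y\<close> is controlled by \<open>D g\<close> in \<open>W\<close>,
      and on \<open>U\<close> the norms of \<open>W\<close> and \<open>U\<close> agree.\<close>
    also have "\<dots> \<le> C1 * mnorm V y" using dom[OF yU] by simp
    also have "\<dots> \<le> C1 * (C2 * mnorm W (D g))" using C1 y_le by (intro mult_left_mono) simp_all
    also have "mnorm W (D g) = mnorm U (D g)" using norms Dg by blast
    finally show "mnorm U (D x) \<le> (C1 * C2) * mnorm U (D (D x))" by (simp add: g_def)
  qed (use C1 C2 in simp)
qed

end
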